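(* Let $G=(V,E)$ be a finite multi-graph, $\mathcal{H}$ a Schrödinger operator on $G$, and $\lambda\in\mathbb{R}$. Suppose there exists $S\subset V$ such that: (i) the induced subgraph $G[S]$ is acyclic, i.e. a forest; (ii) $\lambda$ is an eigenvalue of $\mathcal{H}$ restricted to each connected component of $G[S]$; (iii) $|\partial G[S]|<\mathrm{cc}(G[S])$. Then for every degree-$2$ subgraph $\gamma$ of $G$ (including the empty subgraph), $\lambda$ is a root of the generalized matching polynomial $m^{\mathcal{H}}_{G\setminus\gamma}$.
   Context: Multi-graphs may have self-loops and multiple edges; a self-loop contributes $2$ to the degree of its vertex. $\vec{E}$ is the set of directed edges: every $e\in E$ (including each self-loop) appears in $\vec E$ with both orientations. For $e\in\vec E$, $o(e)$ and $t(e)$ are its origin and terminus and $e^{-1}$ is the same edge with the opposite orientation. A Schrödinger operator on a finite multi-graph $G$ is an operator $\mathcal{H}:\ell^2(V)\to\ell^2(V)$ with matrix entries $\mathcal{H}_{uv}=\sum_{e\in\vec E:\,o(e)=u,\,t(e)=v}w_e+\delta_{uv}\mathcal{V}_v$, where $w_e\in\mathbb{C}$, $w_e=\overline{w_{e^{-1}}}\neq 0$ and $\mathcal{V}_v\in\mathbb{R}$. Its restriction to a subgraph uses the edge weights and potentials of that subgraph. $G[S]$ is the induced subgraph of $G$ on $S$. A self-loop is a cycle of length $1$ and two distinct parallel edges form a cycle of length $2$, so an acyclic graph has neither. For a subgraph $H$ of $G$, $\mathrm{cc}(H)$ is its number of connected components and $\partial H=\partial_G H=\{v\in V\setminus V_H:\exists\,u\in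 V_H\text{ adjacent to }v\}$. A degree-$2$ subgraph of $G$ is a subgraph (not necessarily induced or spanning) in which every vertex has degree $2$, i.e. a vertex-disjoint union of cycles; the empty subgraph is included. $G\setminus\gamma$ is the induced subgraph of $G$ on $V\setminus V_\gamma$. A matching of $G$ is a degree-$1$ subgraph (a set of pairwise disjoint non-loop edges with their endpoints); the empty graph is a matching. For a matching $M$, $V_M$ and $\vec E_M$ denote its vertex set and its set of directed edges (both orientations of each edge). $\mathcal{M}(G)$ is the set of matchings of $G$. The generalized matching polynomial is $$m_G^{\mathcal{H}}(x)=\sum_{M\in\mathcal{M}(G)}(-1)^{|V_M|/2}\prod_{e\in\vec E_M}w_e\cdot\prod_{u\in V\setminus V_M}(x-\mathcal{V}_u),$$ and for a subgraph $G_0$ of $G$, $m^{\mathcal{H}}_{G_0}$ is defined in the same way using the restriction of the weights and potentials to $G_0$ (it is the constant $1$ for the empty graph). *)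

theory Defs
  imports
    "Graph_Theory.Graph_Theory"
    "HOL-Computational_Algebra.Polynomial"
begin

text \<open>
  A finite multi-graph is given by its vertices, its directed edges (\<^const>\<open>arcs\<close>, with origin
  \<^const>\<open>tail\<close> and terminus \<^const>\<open>head\<close>), and the orientation reversal \<open>arev\<close>, which has no fixed
  point on the arcs. An undirected edge is a pair \<open>{e, arev e}\<close>; this includes self-loops, which
  therefore contribute two arcs.
\<close>

locale finite_multigraph = bidirected_digraph G arev + fin_digraph G
  for G :: "('a, 'b) pre_digraph" and arev :: "'b \<Rightarrow> 'b"

definition multi_subgraph ::
    "('b \<Rightarrow> 'b) \<Rightarrow> ('a, 'b) pre_digraph \<Rightarrow> ('a, 'b) pre_digraph \<Rightarrow> bool" where
  "multi_subgraph arev H G \<longleftrightarrow> subgraph H G \<and> (\<forall>e \<in> arcs H. arev e \<in> arcs H)"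

text \<open>
  The degree of a vertex is its \<^const>\<open>out_degree\<close>: a non-loop edge has exactly one orientation
  starting at each of its endpoints, and both orientations of a self-loop start at its vertex.
\<close>

definition degree_subgraph ::
    "nat \<Rightarrow> ('b \<Rightarrow> 'b) \<Rightarrow> ('a, 'b) pre_digraph \<Rightarrow> ('a, 'b) pre_digraph \<Rightarrow> bool" where
  "degree_subgraph k arev H G \<longleftrightarrow>
     multi_subgraph arev H G \<and> (\<forall>v \<in> verts H. out_degree H v = k)"

definition matchings ::
    "('b \<Rightarrow> 'b) \<Rightarrow> ('a, 'b) pre_digraph \<Rightarrow> ('a, 'b) pre_digraph set" where
  "matchings arev G = {M. degree_subgraph 1 arev M G}"

text \<open>
  The library's \<^const>\<open>forest\<close> is about directed cycles, so an edge traversed back and forth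
  would already violate it. Here a cycle must not use both orientations of an edge; cycles of
  length 1 (self-loops) and 2 (parallel edges) are included.
\<close>

definition acyclic_multigraph :: "('b \<Rightarrow> 'b) \<Rightarrow> ('a, 'b) pre_digraph \<Rightarrow> bool" where
  "acyclic_multigraph arev G \<longleftrightarrow>
     \<not> (\<exists>p. pre_digraph.cycle G p \<and> (\<forall>e \<in> set p. arev e \<notin> set p))"

definition components :: "('a, 'b) pre_digraph \<Rightarrow> ('a, 'b) pre_digraph set" where
  "components G = {C. pre_digraph.max_subgraph G connected C}"

definition cc :: "('a, 'b) pre_digraph \<Rightarrow> nat" where
  "cc G = card (components G)"

definition boundary :: "('a, 'b) pre_digraph \<Rightarrow> ('a, 'b) pre_digraph \<Rightarrow> 'a set" where
  "boundary G H = {v \<in> verts G - verts H. \<exists>u \<in> verts H. u \<rightarrow>\<^bsub>G\<^esub> v}"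

text \<open>
  A Schroedinger operator is represented by its edge weights \<open>w\<close> and its potential \<open>V\<close>. Its
  restriction to a subgraph \<open>H\<close> is obtained by passing \<open>H\<close> in place of \<open>G\<close> below.
\<close>

definition schroedinger_data ::
    "('a, 'b) pre_digraph \<Rightarrow> ('b \<Rightarrow> 'b) \<Rightarrow> ('b \<Rightarrow> complex) \<Rightarrow> bool" where
  "schroedinger_data G arev w \<longleftrightarrow> (\<forall>e \<in> arcs G. w e = cnj (w (arev e)) \<and> w e \<noteq> 0)"

definition schroedinger_entry ::
    "('a, 'b) pre_digraph \<Rightarrow> ('b \<Rightarrow> complex) \<Rightarrow> ('a \<Rightarrow> real) \<Rightarrow> 'a \<Rightarrow> 'a \<Rightarrow> complex" where
  "schroedinger_entry G w V u v =
     (\<Sum>e \<in> {e \<in> arcs G. tail G e = u \<and> head G e = v}. w e)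
       + (if u = v then complex_of_real (V v) else 0)"

text \<open>Functions on a finite vertex set are extended by zero to the whole type.\<close>

definition ell2 :: "'a set \<Rightarrow> ('a \<Rightarrow> complex) set" where
  "ell2 A = {f. \<forall>v. v \<notin> A \<longrightarrow> f v = 0}"

definition schroedinger_op ::
    "('a, 'b) pre_digraph \<Rightarrow> ('b \<Rightarrow> complex) \<Rightarrow> ('a \<Rightarrow> real) \<Rightarrow> ('a \<Rightarrow> complex) \<Rightarrow> 'a \<Rightarrow> complex" where
  "schroedinger_op G w V f =
     (\<lambda>u. if u \<in> verts G then \<Sum>v \<in> verts G. schroedinger_entry G w V u v * f v else 0)"

definition schroedinger_eigenvalue ::
    "('a, 'b) pre_digraph \<Rightarrow> ('b \<Rightarrow> complex) \<Rightarrow> ('a \<Rightarrow> real) \<Rightarrow> complex \<Rightarrow> bool" where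
  "schroedinger_eigenvalue G w V c \<longleftrightarrow>
     (\<exists>f \<in> ell2 (verts G). f \<noteq> (\<lambda>v. 0) \<and> schroedinger_op G w V f = (\<lambda>v. c * f v))"

definition matching_poly ::
    "('b \<Rightarrow> 'b) \<Rightarrow> ('b \<Rightarrow> complex) \<Rightarrow> ('a \<Rightarrow> real) \<Rightarrow> ('a, 'b) pre_digraph \<Rightarrow> complex poly" where
  "matching_poly arev w V G =
     (\<Sum>M \<in> matchings arev G.
        smult ((-1) ^ (card (verts M) div 2) * (\<Prod>e \<in> arcs M. w e))
          (\<Prod>u \<in> verts G - verts M. [:- complex_of_real (V u), 1:]))"

end

theory Submission
  imports Defs "HOL-Library.Landau_Symbols"
begin

text \<open>
  The idea is to count the order of vanishing at \<open>\<lambda>\<close> and to show that too few vertices are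
  removed or added to destroy it. Write \<open>M(A)\<close> for the matching polynomial of the induced subgraph on
  \<open>A\<close>, evaluated at \<open>\<lambda> + i\<epsilon>\<close> with \<open>\<epsilon> > 0\<close> small.

  On a forest the matching polynomial vanishes at the eigenvalues of the operator
  (\<open>kernel_imp_M_eq_0\<close>, proved by stripping leaves), so each component of \<open>G[S]\<close> contributes a factor
  \<open>O(\<epsilon>)\<close> and \<open>M(S) = O(\<epsilon>\<^sup>k)\<close> with \<open>k\<close> the number of components (\<open>near_forest\<close>).

  Two facts of Heilmann-Lieb type control how the order changes. Expanding the matching sum at a vertex
  gives \<open>M(A)/M(A - v) = c\<^sub>v - \<Sum>\<^sub>u b\<^sub>v\<^sub>u M(A - v - u)/M(A - v)\<close> with \<open>b \<ge> 0\<close>, and by induction the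
  left-hand side has imaginary part at least \<open>\<epsilon>\<close>, so the
  quotients on the right are at most \<open>1/\<epsilon>\<close>. Hence adding a vertex costs at most one
  order (\<open>near_insert\<close>). Keeping only the terms along a path in this expansion, one finds that deleting all the
  vertices of a path, however long, also costs at most one order (\<open>near_delete_path\<close>).

  It remains to pass from \<open>S\<close> to \<open>G \<setminus> \<gamma>\<close>. The vertices of \<open>\<gamma>\<close> in \<open>S\<close> have to be deleted, and the
  boundary vertices outside \<open>\<gamma>\<close> added; the rest of \<open>G \<setminus> \<gamma>\<close> is not adjacent to \<open>S\<close> and only contributes
  a bounded factor. Inside the forest \<open>\<gamma>\<close> is a union of paths (\<open>path_cover\<close>); every
  path is left by \<open>\<gamma>\<close> at both ends into the boundary, where \<open>\<gamma>\<close> has degree 2, so there are at most as many paths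
  as boundary vertices on \<open>\<gamma>\<close> (\<open>degree2_count\<close>). Altogether at most \<open>|\<partial>G[S]| < k\<close> orders are lost, so
  \<open>M(G \<setminus> \<gamma>) = O(\<epsilon>)\<close>.
\<close>

section \<open>Functions satisfying the matching recurrence\<close>

text \<open>
  The recurrence is all that the argument needs to know about matchings: \<open>M c A\<close> stands for the matching
  sum over the vertex set \<open>A\<close>, with the factor \<open>c u\<close> for an unmatched vertex \<open>u\<close> and \<open>b v u\<close> for the
  total of \<open>\<bar>w\<^sub>e\<bar>\<^sup>2\<close> over the edges between \<open>v\<close> and \<open>u\<close>. The vertex factors are a parameter because
  stripping a leaf from a forest replaces the factor of its neighbour.
\<close>

locale matching_recurrence =
  fixes b :: "'a \<Rightarrow> 'a \<Rightarrow> real" and M :: "('a \<Rightarrow> complex) \<Rightarrow> 'a set \<Rightarrow> complex"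
  assumes b_nonneg: "0 \<le> b u v"
    and M_empty: "M c {} = 1"
    and M_step: "finite A \<Longrightarrow> v \<in> A \<Longrightarrow>
      M c A = c v * M c (A - {v}) - (\<Sum>u\<in>A - {v}. of_real (b v u) * M c (A - {v} - {u}))"
begin

lemma M_cong:
  assumes "finite A" and "\<And>v. v \<in> A \<Longrightarrow> c v = d v"
  shows "M c A = M d A"
  using assms
proof (induction A rule: finite_psubset_induct)
  case (psubset A)
  show ?case
  proof (cases "A = {}")
    case False
    then obtain v where v: "v \<in> A" by blast
    have "M c B = M d B" if "B \<subset> A" for B
    proof (rule psubset.IH[OF that])
      show "c u = d u" if "u \<in> B" for u
        using that \<open>B \<subset> A\<close> by (intro psubset.prems) blast
    qed
    moreover have "A - {v} - {u} \<subset> A" "A - {v} \<subset> A" for u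
      using v by blast+
    ultimately have "M c (A - {v}) = M d (A - {v})"
      "\<And>u. M c (A - {v} - {u}) = M d (A - {v} - {u})"
      by simp_all
    then show ?thesis
      using psubset.prems[OF v] by (simp add: M_step[OF psubset.hyps v] cong: sum.cong)
  qed (simp add: M_empty)
qed

lemma M_disjoint_Un:
  assumes "finite A" "finite B" "A \<inter> B = {}"
    and "\<And>u v. u \<in> A \<Longrightarrow> v \<in> B \<Longrightarrow> b u v = 0"
  shows "M c (A \<union> B) = M c A * M c B"
  using assms(1,3,4)
proof (induction A rule: finite_psubset_induct)
  case (psubset A)
  show ?case
  proof (cases "A = {}")
    case False
    then obtain v where v: "v \<in> A" by blast
    have IH: "M c (C \<union> B) = M c C * M c B" if "C \<subset> A" for C
      by (rule psubset.IH[OF that]) (use psubset.prems that in blast)+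
    have split: "A \<union> B - {v} = (A - {v}) \<union> B" using v psubset.prems by blast
    have "(\<Sum>u\<in>A \<union> B - {v}. of_real (b v u) * M c (A \<union> B - {v} - {u}))
        = (\<Sum>u\<in>A - {v}. of_real (b v u) * M c (A \<union> B - {v} - {u}))
        + (\<Sum>u\<in>B. of_real (b v u) * M c (A \<union> B - {v} - {u}))"
      unfolding split using psubset.hyps psubset.prems assms(2) by (intro sum.union_disjoint) auto
    also have "(\<Sum>u\<in>B. of_real (b v u) * M c (A \<union> B - {v} - {u})) = 0"
      using psubset.prems(2)[OF v] by simp
    also have "(\<Sum>u\<in>A - {v}. of_real (b v u) * M c (A \<union> B - {v} - {u}))
        = (\<Sum>u\<in>A - {v}. of_real (b v u) * M c (A - {v} - {u})) * M c B"
      unfolding sum_distrib_right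
    proof (rule sum.cong[OF refl])
      fix u assume u: "u \<in> A - {v}"
      have "A \<union> B - {v} - {u} = (A - {v} - {u}) \<union> B" using u v psubset.prems by blast
      moreover have "A - {v} - {u} \<subset> A" using v by blast
      ultimately show "complex_of_real (b v u) * M c (A \<union> B - {v} - {u})
          = of_real (b v u) * M c (A - {v} - {u}) * M c B"
        using IH[of "A - {v} - {u}"] by simp
    qed
    finally have "M c (A \<union> B) = c v * M c ((A - {v}) \<union> B)
        - (\<Sum>u\<in>A - {v}. of_real (b v u) * M c (A - {v} - {u})) * M c B"
      using M_step[of "A \<union> B" v c] v psubset.hyps assms(2) by (simp add: split)
    also have "M c ((A - {v}) \<union> B) = M c (A - {v}) * M c B" using IH[of "A - {v}"] v by blast
    finally show ?thesis
      by (simp add: M_step[OF psubset.hyps v] algebra_simps)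
  qed (simp add: M_empty)
qed

lemma M_disjoint_UNION:
  assumes "finite I" and "\<And>i. i \<in> I \<Longrightarrow> finite (A i)"
    and "\<And>i j. i \<in> I \<Longrightarrow> j \<in> I \<Longrightarrow> i \<noteq> j \<Longrightarrow> A i \<inter> A j = {}"
    and "\<And>i j u v. i \<in> I \<Longrightarrow> j \<in> I \<Longrightarrow> i \<noteq> j \<Longrightarrow> u \<in> A i \<Longrightarrow> v \<in> A j \<Longrightarrow> b u v = 0"
  shows "M c (\<Union>i\<in>I. A i) = (\<Prod>i\<in>I. M c (A i))"
  using assms
proof (induction I rule: finite_induct)
  case (insert i I)
  have "M c (A i \<union> (\<Union>j\<in>I. A j)) = M c (A i) * M c (\<Union>j\<in>I. A j)"
  proof (rule M_disjoint_Un)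
    show "A i \<inter> (\<Union>j\<in>I. A j) = {}" using insert.prems(2)[of i] insert.hyps(2) by fastforce
    show "b u v = 0" if "u \<in> A i" "v \<in> (\<Union>j\<in>I. A j)" for u v
      using that insert.prems(3)[of i] insert.hyps(2) by blast
  qed (use insert in auto)
  moreover have "M c (\<Union>j\<in>I. A j) = (\<Prod>j\<in>I. M c (A j))"
  proof (rule insert.IH)
    show "finite (A j)" if "j \<in> I" for j
      using that by (intro insert.prems(1)) simp
    show "A j \<inter> A k = {}" if "j \<in> I" "k \<in> I" "j \<noteq> k" for j k
      using that by (intro insert.prems(2)) auto
    show "b u v = 0" if "j \<in> I" "k \<in> I" "j \<noteq> k" "u \<in> A j" "v \<in> A k" for j k u v
      using that by (intro insert.prems(3)[of j k]) auto
  qed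
  ultimately show ?case using insert.hyps by simp
qed (simp add: M_empty)

lemma M_shift_potential:
  assumes "finite A" "u \<in> A" and "\<And>v. v \<in> A \<Longrightarrow> v \<noteq> u \<Longrightarrow> d v = c v"
  shows "M d A = M c A + (d u - c u) * M c (A - {u})"
proof -
  have eq: "M d B = M c B" if "B \<subseteq> A - {u}" for B
  proof (rule M_cong)
    show "finite B" using that assms(1) by (meson finite_Diff finite_subset)
    show "d v = c v" if "v \<in> B" for v
      using that \<open>B \<subseteq> A - {u}\<close> by (intro assms(3)) auto
  qed
  have "(\<Sum>v\<in>A - {u}. of_real (b u v) * M d (A - {u} - {v}))
      = (\<Sum>v\<in>A - {u}. of_real (b u v) * M c (A - {u} - {v}))"
    by (intro sum.cong refl) (simp add: eq Diff_subset)
  moreover have "M d (A - {u}) = M c (A - {u})" by (rule eq) simp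
  ultimately show ?thesis
    unfolding M_step[OF assms(1,2), of d] M_step[OF assms(1,2), of c] left_diff_distrib
    by simp
qed

end

section \<open>Kernel vectors on forests\<close>

context matching_recurrence
begin

text \<open>
  Leaves and isolated vertices of \<open>B\<close>. The equation \<open>b v u = h v u * h u v\<close>
  expresses that \<open>v\<close> and \<open>u\<close> are joined by a single edge, since with parallel edges
  \<open>\<Sum>\<bar>w\<^sub>e\<bar>\<^sup>2\<close> differs from \<open>\<bar>\<Sum>w\<^sub>e\<bar>\<^sup>2\<close>.
\<close>

definition pendant :: "('a \<Rightarrow> 'a \<Rightarrow> complex) \<Rightarrow> 'a set \<Rightarrow> 'a \<Rightarrow> bool" where
  "pendant h B v \<longleftrightarrow>
     (\<forall>y\<in>B. h v y = 0 \<and> h y v = 0 \<and> b v y = 0) \<or>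
     (\<exists>u\<in>B - {v}. h v u \<noteq> 0 \<and> h u v \<noteq> 0 \<and> of_real (b v u) = h v u * h u v \<and>
        (\<forall>y\<in>B - {u}. h v y = 0 \<and> h y v = 0 \<and> b v y = 0))"

text \<open>
  On a forest the matching sum agrees with the determinant of \<open>c - h\<close>, so it vanishes as soon as there is
  a kernel vector. Indeed a kernel vector survives Gaussian elimination at a leaf \<open>v\<close>
  with neighbour \<open>u\<close>. If \<open>c v \<noteq> 0\<close>, eliminating \<open>v\<close> lowers \<open>c u\<close> by \<open>h v u * h u v / c v\<close> and divides \<open>M\<close> by
  \<open>c v\<close>; if \<open>c v = 0\<close>, the vector vanishes at \<open>u\<close> and both vertices can be dropped.
\<close>

lemma kernel_imp_M_eq_0:
  fixes h :: "'a \<Rightarrow> 'a \<Rightarrow> complex"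
  assumes "finite A"
    and leaf: "\<And>B. B \<subseteq> A \<Longrightarrow> B \<noteq> {} \<Longrightarrow> \<exists>v\<in>B. pendant h B v"
    and ker: "\<And>u. u \<in> A \<Longrightarrow> c u * f u = (\<Sum>y\<in>A. h u y * f y)"
    and nz: "\<exists>u\<in>A. f u \<noteq> 0"
  shows "M c A = 0"
  using assms
proof (induction A arbitrary: c f rule: finite_psubset_induct)
  case (psubset A)
  note fin = psubset.hyps
  have IH: "M d B = 0" if B: "B \<subset> A"
    and "\<And>u. u \<in> B \<Longrightarrow> d u * f u = (\<Sum>y\<in>B. h u y * f y)" and "\<exists>u\<in>B. f u \<noteq> 0" for d B
  proof (rule psubset.IH[OF B _ that(2,3)])
    show "\<exists>v\<in>C. pendant h C v" if "C \<subseteq> B" "C \<noteq> {}" for C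
      using B that by (intro psubset.prems(1)) auto
  qed
  have "A \<noteq> {}" using psubset.prems(3) by blast
  with psubset.prems(1)[OF order_refl] obtain v where v: "v \<in> A" and pend: "pendant h A v"
    by blast
  have split: "(\<Sum>y\<in>A. h x y * f y) = h x v * f v + (\<Sum>y\<in>A - {v}. h x y * f y)" for x
    using fin v by (rule sum.remove)
  show ?case
  proof (cases "\<forall>y\<in>A. h v y = 0 \<and> h y v = 0 \<and> b v y = 0")
    case True
    then have iso: "h v y = 0 \<and> h y v = 0 \<and> b v y = 0" if "y \<in> A" for y
      using that by blast
    have M: "M c A = c v * M c (A - {v})" by (simp add: M_step[OF fin v] iso)
    show ?thesis
    proof (cases "f v = 0")
      case True
      have "M c (A - {v}) = 0"
      proof (rule IH)
        show "A - {v} \<subset> A" using v by blast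
        show "c x * f x = (\<Sum>y\<in>A - {v}. h x y * f y)" if "x \<in> A - {v}" for x
          using psubset.prems(2)[of x] that iso[of x] by (simp add: split)
        show "\<exists>x\<in>A - {v}. f x \<noteq> 0" using psubset.prems(3) True by auto
      qed
      then show ?thesis by (simp add: M)
    next
      case f: False
      have "c v * f v = 0" using psubset.prems(2)[OF v] iso by simp
      with f show ?thesis by (simp add: M)
    qed
  next
    case False
    with pend obtain u where u: "u \<in> A"
      and edge: "u \<noteq> v \<and> h v u \<noteq> 0 \<and> h u v \<noteq> 0 \<and> of_real (b v u) = h v u * h u v"
      and other: "\<And>y. y \<in> A - {u} \<Longrightarrow> h v y = 0 \<and> h y v = 0 \<and> b v y = 0"
      unfolding pendant_def by blast
    have M: "M c A = c v * M c (A - {v}) - h v u * h u v * M c (A - {v} - {u})"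
    proof -
      have "(\<Sum>y\<in>A - {v}. of_real (b v y) * M c (A - {v} - {y}))
          = of_real (b v u) * M c (A - {v} - {u})
            + (\<Sum>y\<in>A - {v} - {u}. of_real (b v y) * M c (A - {v} - {y}))"
        using fin u edge by (intro sum.remove) auto
      also have "(\<Sum>y\<in>A - {v} - {u}. of_real (b v y) * M c (A - {v} - {y})) = 0"
        using other by (intro sum.neutral) auto
      finally show ?thesis using edge by (simp add: M_step[OF fin v])
    qed
    have at_v: "c v * f v = h v u * f u"
    proof -
      have "(\<Sum>y\<in>A. h v y * f y) = h v u * f u + (\<Sum>y\<in>A - {u}. h v y * f y)"
        using fin u by (rule sum.remove)
      also have "(\<Sum>y\<in>A - {u}. h v y * f y) = 0"
        using other by (intro sum.neutral) auto
      finally show ?thesis using psubset.prems(2)[OF v] by simp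
    qed
    show ?thesis
    proof (cases "c v = 0")
      case True
      then have fu: "f u = 0" using at_v edge by simp
      have ker: "c x * f x = h x v * f v + (\<Sum>y\<in>A - {v} - {u}. h x y * f y)" if "x \<in> A" for x
      proof -
        have "(\<Sum>y\<in>A - {v}. h x y * f y) = h x u * f u + (\<Sum>y\<in>A - {v} - {u}. h x y * f y)"
          using fin u edge by (intro sum.remove) auto
        then show ?thesis using psubset.prems(2)[OF that] by (simp add: split fu)
      qed
      have "M c (A - {v} - {u}) = 0"
      proof (rule IH)
        show "A - {v} - {u} \<subset> A" using v by blast
        show "c x * f x = (\<Sum>y\<in>A - {v} - {u}. h x y * f y)" if "x \<in> A - {v} - {u}" for x
          using ker[of x] other[of x] that by simp
        show "\<exists>x\<in>A - {v} - {u}. f x \<noteq> 0"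
        proof (rule ccontr)
          assume no: "\<not> ?thesis"
          then have "(\<Sum>y\<in>A - {v} - {u}. h u y * f y) = 0" by (intro sum.neutral) auto
          then have "f v = 0" using ker[OF u] fu edge by simp
          then show False using psubset.prems(3) no fu by auto
        qed
      qed
      then show ?thesis using True by (simp add: M)
    next
      case False
      define d where "d = c(u := c u - h v u * h u v / c v)"
      have fv: "f v = h v u * f u / c v" using at_v False by (simp add: field_simps)
      have "M d (A - {v}) = M c (A - {v}) + (d u - c u) * M c (A - {v} - {u})"
        using fin u edge by (intro M_shift_potential) (auto simp: d_def)
      then have "M c A = c v * M d (A - {v})"
        using False by (simp add: M d_def field_simps)
      moreover have "M d (A - {v}) = 0"
      proof (rule IH)
        show "A - {v} \<subset> A" using v by blast
        show "d x * f x = (\<Sum>y\<in>A - {v}. h x y * f y)" if x: "x \<in> A - {v}" for x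
        proof (cases "x = u")
          case True
          have "d u * f u = c u * f u - h u v * f v" by (simp add: d_def fv algebra_simps)
          also have "\<dots> = (\<Sum>y\<in>A - {v}. h u y * f y)"
            using psubset.prems(2)[OF u] by (simp add: split)
          finally show ?thesis using True by simp
        next
          case False
          then show ?thesis using psubset.prems(2)[of x] other[of x] x by (simp add: split d_def)
        qed
        show "\<exists>x\<in>A - {v}. f x \<noteq> 0"
        proof (rule ccontr)
          assume no: "\<not> ?thesis"
          then have "f u = 0" using u edge by auto
          then have "f v = 0" by (simp add: fv)
          then show False using psubset.prems(3) no by auto
        qed
      qed
      ultimately show ?thesis by simp
    qed
  qed
qed

end

section \<open>Deletion estimates in the upper half-plane\<close>

lemma Im_inverse_neg: "Im z > 0 \<Longrightarrow> Im (inverse z) < 0"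
  by (simp add: sum_power2_gt_zero_iff divide_pos_pos)

context matching_recurrence
begin

definition ratio :: "('a \<Rightarrow> complex) \<Rightarrow> 'a set \<Rightarrow> 'a \<Rightarrow> complex" where
  "ratio c A v = M c (A - {v}) / M c A"

text \<open>
  The Heilmann-Lieb argument. By the recurrence \<open>1 / ratio c A v\<close> equals \<open>c v\<close> minus a nonnegative
  combination of the \<open>ratio c (A - {v}) u\<close>, and these have negative imaginary part because their
  inverses have positive imaginary part by induction.
\<close>

lemma M_nonzero_and_ratio:
  assumes "finite A" "0 < \<epsilon>" and "\<And>v. v \<in> A \<Longrightarrow> \<epsilon> \<le> Im (c v)"
  shows "M c A \<noteq> 0 \<and> (\<forall>v\<in>A. \<epsilon> \<le> Im (inverse (ratio c A v)))"
  using assms(1,3)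
proof (induction A rule: finite_psubset_induct)
  case (psubset A)
  have IH: "M c B \<noteq> 0 \<and> (\<forall>v\<in>B. \<epsilon> \<le> Im (inverse (ratio c B v)))" if "B \<subset> A" for B
  proof (rule psubset.IH[OF that])
    show "\<epsilon> \<le> Im (c v)" if "v \<in> B" for v
      using that \<open>B \<subset> A\<close> by (intro psubset.prems) blast
  qed
  have bound: "\<epsilon> \<le> Im (inverse (ratio c A v)) \<and> M c A \<noteq> 0" if v: "v \<in> A" for v
  proof -
    have nz: "M c (A - {v}) \<noteq> 0" using IH[of "A - {v}"] v by blast
    have "M c A / M c (A - {v}) = c v - (\<Sum>u\<in>A - {v}. of_real (b v u) * ratio c (A - {v}) u)"
      using nz by (simp add: M_step[OF psubset.hyps v] diff_divide_distrib ratio_def sum_divide_distrib)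
    then have eq: "inverse (ratio c A v) = c v - (\<Sum>u\<in>A - {v}. of_real (b v u) * ratio c (A - {v}) u)"
      by (simp add: ratio_def)
    have "Im (ratio c (A - {v}) u) \<le> 0" if "u \<in> A - {v}" for u
    proof -
      have "\<epsilon> \<le> Im (inverse (ratio c (A - {v}) u))" using IH[of "A - {v}"] v that by blast
      then have "Im (inverse (inverse (ratio c (A - {v}) u))) < 0"
        using assms(2) by (intro Im_inverse_neg) simp
      then show ?thesis by simp
    qed
    then have "(\<Sum>u\<in>A - {v}. b v u * Im (ratio c (A - {v}) u)) \<le> 0"
      by (intro sum_nonpos mult_nonneg_nonpos b_nonneg)
    then have "\<epsilon> \<le> Im (inverse (ratio c A v))"
      using psubset.prems[OF v] by (simp add: eq)
    moreover from this assms(2) have "M c A \<noteq> 0"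
      by (auto simp: ratio_def)
    ultimately show ?thesis by blast
  qed
  show ?case
  proof (cases "A = {}")
    case False
    then show ?thesis using bound by blast
  qed (simp add: M_empty)
qed

context
  fixes c :: "'a \<Rightarrow> complex" and A :: "'a set" and \<epsilon> :: real
  assumes fin: "finite A" and eps: "0 < \<epsilon>" and Im_c: "\<And>v. v \<in> A \<Longrightarrow> \<epsilon> \<le> Im (c v)"
begin

lemma M_nonzero: "B \<subseteq> A \<Longrightarrow> M c B \<noteq> 0"
  and Im_inverse_ratio: "B \<subseteq> A \<Longrightarrow> v \<in> B \<Longrightarrow> \<epsilon> \<le> Im (inverse (ratio c B v))"
  using M_nonzero_and_ratio[of B \<epsilon> c] finite_subset[OF _ fin] eps Im_c by blast+

lemma norm_ratio_le: "v \<in> A \<Longrightarrow> cmod (ratio c A v) \<le> 1 / \<epsilon>"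
proof -
  assume v: "v \<in> A"
  have "\<epsilon> \<le> cmod (inverse (ratio c A v))"
    using Im_inverse_ratio[OF order_refl v] abs_Im_le_cmod[of "inverse (ratio c A v)"] by linarith
  then have "inverse (cmod (inverse (ratio c A v))) \<le> inverse \<epsilon>"
    using eps by (intro le_imp_inverse_le)
  then show ?thesis unfolding norm_inverse inverse_inverse_eq by (simp add: inverse_eq_divide)
qed

end

lemma norm_insert_le:
  assumes "finite A" "0 < \<epsilon>" and "\<And>v. v \<in> A \<Longrightarrow> \<epsilon> \<le> Im (c v)" and v: "v \<in> A"
  shows "cmod (M c A) \<le> (cmod (c v) + (\<Sum>u\<in>A - {v}. b v u) / \<epsilon>) * cmod (M c (A - {v}))"
proof -
  have nz: "M c (A - {v}) \<noteq> 0" using M_nonzero[of A \<epsilon> c "A - {v}"] assms by blast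
  have "M c A = (c v - (\<Sum>u\<in>A - {v}. of_real (b v u) * ratio c (A - {v}) u)) * M c (A - {v})"
    using nz by (simp add: M_step[OF assms(1) v] left_diff_distrib ratio_def sum_distrib_right)
  moreover have "cmod (\<Sum>u\<in>A - {v}. of_real (b v u) * ratio c (A - {v}) u) \<le> (\<Sum>u\<in>A - {v}. b v u * (1 / \<epsilon>))"
  proof (rule sum_norm_le)
    fix u assume "u \<in> A - {v}"
    then have "cmod (ratio c (A - {v}) u) \<le> 1 / \<epsilon>"
      by (intro norm_ratio_le) (use assms in auto)
    then show "cmod (of_real (b v u) * ratio c (A - {v}) u) \<le> b v u * (1 / \<epsilon>)"
      by (simp add: norm_mult b_nonneg mult_left_mono del: times_divide_eq_right)
  qed
  then have "cmod (c v - (\<Sum>u\<in>A - {v}. of_real (b v u) * ratio c (A - {v}) u))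
      \<le> cmod (c v) + (\<Sum>u\<in>A - {v}. b v u) / \<epsilon>"
    using norm_triangle_ineq4[of "c v" "\<Sum>u\<in>A - {v}. of_real (b v u) * ratio c (A - {v}) u"]
    by (simp add: sum_divide_distrib)
  ultimately show ?thesis by (simp add: norm_mult mult_right_mono)
qed

lemma neg_Im_ratio:
  assumes "finite A" "0 < \<epsilon>" and "\<And>v. v \<in> A \<Longrightarrow> \<epsilon> \<le> Im (c v)" and v: "v \<in> A"
  shows "- Im (ratio c A v) = (cmod (ratio c A v))\<^sup>2 * (Im (c v) + (\<Sum>u\<in>A - {v}. b v u * - Im (ratio c (A - {v}) u)))"
proof -
  have nz: "M c (A - {v}) \<noteq> 0" "M c A \<noteq> 0" using M_nonzero[of A \<epsilon> c] assms by blast+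
  have "M c A / M c (A - {v}) = c v - (\<Sum>u\<in>A - {v}. of_real (b v u) * ratio c (A - {v}) u)"
    using nz by (simp add: M_step[OF assms(1) v] diff_divide_distrib ratio_def sum_divide_distrib)
  then have eq: "inverse (ratio c A v) = c v - (\<Sum>u\<in>A - {v}. of_real (b v u) * ratio c (A - {v}) u)"
    by (simp add: ratio_def)
  have "ratio c A v \<noteq> 0" using nz by (simp add: ratio_def)
  then have "- Im (ratio c A v) = (cmod (ratio c A v))\<^sup>2 * Im (inverse (ratio c A v))"
    by (simp add: cmod_power2 complex_neq_0)
  then show ?thesis by (simp add: eq sum_negf)
qed

lemma neg_Im_ratio_nonneg:
  assumes "finite A" "0 < \<epsilon>" and "\<And>v. v \<in> A \<Longrightarrow> \<epsilon> \<le> Im (c v)" and v: "v \<in> A"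
  shows "0 \<le> - Im (ratio c A v)"
proof -
  have "\<epsilon> \<le> Im (inverse (ratio c A v))" using Im_inverse_ratio[of A \<epsilon> c A v] assms by blast
  then have "Im (inverse (inverse (ratio c A v))) < 0" using assms(2) by (intro Im_inverse_neg) simp
  then show ?thesis by simp
qed

fun path_weight :: "'a list \<Rightarrow> real" where
  "path_weight (u # v # vs) = b u v * path_weight (v # vs)"
| "path_weight vs = 1"

lemma path_weight_pos: "successively (\<lambda>u v. 0 < b u v) vs \<Longrightarrow> 0 < path_weight vs"
  by (induction vs rule: path_weight.induct) auto

text \<open>
  Every summand in \<open>neg_Im_ratio\<close> is nonnegative, so \<open>- Im (ratio c A v)\<close> is at least \<open>\<bar>ratio c A v\<bar>\<^sup>2 * b v w\<close>
  times the same quantity for the next vertex \<open>w\<close> of the path in \<open>A - {v}\<close>. The product of the ratios collected along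
  the path telescopes.
\<close>

lemma neg_Im_ratio_ge_path:
  assumes "finite A" "0 < \<epsilon>" and "\<And>v. v \<in> A \<Longrightarrow> \<epsilon> \<le> Im (c v)"
    and "distinct (v # vs)" "set (v # vs) \<subseteq> A"
  shows "path_weight (v # vs) * \<epsilon> * (cmod (M c (A - set (v # vs)) / M c A))\<^sup>2 \<le> - Im (ratio c A v)"
  using assms(1,3-)
proof (induction vs arbitrary: v A)
  case Nil
  have v: "v \<in> A" using Nil.prems by simp
  have "0 \<le> (\<Sum>u\<in>A - {v}. b v u * - Im (ratio c (A - {v}) u))"
    by (intro sum_nonneg mult_nonneg_nonneg b_nonneg neg_Im_ratio_nonneg[OF _ assms(2)])
      (use Nil.prems in auto)
  then have "\<epsilon> \<le> Im (c v) + (\<Sum>u\<in>A - {v}. b v u * - Im (ratio c (A - {v}) u))"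
    using Nil.prems(2)[OF v] by linarith
  then have "(cmod (ratio c A v))\<^sup>2 * \<epsilon> \<le> - Im (ratio c A v)"
    by (subst neg_Im_ratio[OF Nil.prems(1) assms(2) Nil.prems(2) v]) (auto intro: mult_left_mono)
  then show ?case by (simp add: ratio_def mult.commute)
next
  case (Cons w vs)
  have v: "v \<in> A" and w: "w \<in> A - {v}" using Cons.prems by auto
  have nz: "M c (A - {v}) \<noteq> 0" using M_nonzero[of A \<epsilon> c] Cons.prems assms(2) by blast
  define Q where "Q = M c (A - set (v # w # vs)) / M c (A - {v})"
  have "A - {v} - set (w # vs) = A - set (v # w # vs)" by auto
  then have IH: "path_weight (w # vs) * \<epsilon> * (cmod Q)\<^sup>2 \<le> - Im (ratio c (A - {v}) w)"
    using Cons.IH[of "A - {v}" w] Cons.prems by (auto simp: Q_def)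
  have "b v w * - Im (ratio c (A - {v}) w) \<le> (\<Sum>u\<in>A - {v}. b v u * - Im (ratio c (A - {v}) u))"
    by (rule member_le_sum[OF w])
      (intro mult_nonneg_nonneg b_nonneg neg_Im_ratio_nonneg[OF _ assms(2)],
        use Cons.prems in auto)
  moreover have "0 \<le> Im (c v)" using Cons.prems(2)[OF v] assms(2) by linarith
  moreover have "b v w * (path_weight (w # vs) * \<epsilon> * (cmod Q)\<^sup>2) \<le> b v w * - Im (ratio c (A - {v}) w)"
    using IH by (intro mult_left_mono b_nonneg)
  ultimately have "b v w * (path_weight (w # vs) * \<epsilon> * (cmod Q)\<^sup>2)
      \<le> Im (c v) + (\<Sum>u\<in>A - {v}. b v u * - Im (ratio c (A - {v}) u))" by linarith
  then have "(cmod (ratio c A v))\<^sup>2 * (b v w * (path_weight (w # vs) * \<epsilon> * (cmod Q)\<^sup>2)) \<le> - Im (ratio c A v)"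
    by (subst neg_Im_ratio[OF Cons.prems(1) assms(2) Cons.prems(2) v]) (auto intro: mult_left_mono)
  moreover have "M c (A - set (v # w # vs)) / M c A = Q * ratio c A v"
    using nz by (simp add: Q_def ratio_def)
  ultimately show ?case by (simp add: norm_mult power_mult_distrib mult_ac)
qed

text \<open>
  Combined with \<open>- Im (ratio c A v) \<le> 1 / \<epsilon>\<close>, the path bound has \<open>\<epsilon>\<^sup>2\<close> against the squared quotient:
  a single power of \<open>\<epsilon>\<close> is lost for a path of any length.
\<close>

lemma norm_delete_path_le:
  assumes "finite A" "0 < \<epsilon>" and "\<And>v. v \<in> A \<Longrightarrow> \<epsilon> \<le> Im (c v)"
    and vs: "vs \<noteq> []" "distinct vs" "set vs \<subseteq> A" "successively (\<lambda>u v. 0 < b u v) vs"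
  shows "\<epsilon> * cmod (M c (A - set vs)) \<le> 1 / sqrt (path_weight vs) * cmod (M c A)"
proof -
  obtain v us where v: "vs = v # us" using vs(1) by (cases vs) auto
  have pos: "0 < path_weight vs" using vs(4) by (rule path_weight_pos)
  have nz: "M c A \<noteq> 0" using M_nonzero[of A \<epsilon> c] assms by blast
  define q where "q = cmod (M c (A - set vs)) / cmod (M c A)"
  have "path_weight vs * \<epsilon> * q\<^sup>2 \<le> - Im (ratio c A v)"
    using neg_Im_ratio_ge_path[where v = v and vs = us, OF assms(1-3)] vs by (simp add: v q_def norm_divide)
  also have "\<dots> \<le> cmod (ratio c A v)" using abs_Im_le_cmod[of "ratio c A v"] by linarith
  also have "\<dots> \<le> 1 / \<epsilon>" by (rule norm_ratio_le) (use assms v in auto)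
  finally have "path_weight vs * (\<epsilon> * q)\<^sup>2 \<le> 1"
    using assms(2) by (simp add: field_simps power2_eq_square)
  then have "(\<epsilon> * q)\<^sup>2 \<le> 1 / path_weight vs" using pos by (simp add: field_simps)
  then have "\<epsilon> * q \<le> sqrt (1 / path_weight vs)" by (rule real_le_rsqrt)
  then have "\<epsilon> * q \<le> 1 / sqrt (path_weight vs)" by (simp add: real_sqrt_divide)
  then show ?thesis using nz by (simp add: q_def field_simps)
qed

end

section \<open>Orders of vanishing\<close>

context matching_recurrence
begin

text \<open>
  The order of vanishing of the matching polynomial at \<open>lam\<close> is read off from its size along the vertical
  half-line above \<open>lam\<close>.
\<close>

definition near :: "('a \<Rightarrow> real) \<Rightarrow> real \<Rightarrow> 'a set \<Rightarrow> real \<Rightarrow> complex" where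
  "near V lam A \<epsilon> = M (\<lambda>v. Complex (lam - V v) \<epsilon>) A"

lemma near_poly:
  assumes "finite A"
  shows "\<exists>p. \<forall>\<epsilon>. near V lam A \<epsilon> = poly p (of_real \<epsilon>)"
  using assms
proof (induction A rule: finite_psubset_induct)
  case (psubset A)
  show ?case
  proof (cases "A = {}")
    case True
    then show ?thesis by (intro exI[of _ 1]) (simp add: near_def M_empty)
  next
    case False
    then obtain v where v: "v \<in> A" by blast
    have "\<forall>B. \<exists>p. B \<subset> A \<longrightarrow> (\<forall>\<epsilon>. near V lam B \<epsilon> = poly p (of_real \<epsilon>))"
      using psubset.IH by blast
    then obtain p where p: "\<And>B \<epsilon>. B \<subset> A \<Longrightarrow> near V lam B \<epsilon> = poly (p B) (of_real \<epsilon>)"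
      by metis
    have sub: "A - {v} - {u} \<subset> A" "A - {v} \<subset> A" for u using v by blast+
    have "Complex (lam - V v) \<epsilon> = poly [:of_real (lam - V v), \<i>:] (of_real \<epsilon>)" for \<epsilon>
      by (simp add: complex_eq_iff)
    then obtain q where q: "\<And>\<epsilon>. Complex (lam - V v) \<epsilon> = poly q (of_real \<epsilon>)" by blast
    have "near V lam A \<epsilon> = poly (q * p (A - {v})
        - (\<Sum>u\<in>A - {v}. smult (of_real (b v u)) (p (A - {v} - {u})))) (of_real \<epsilon>)" for \<epsilon>
      using p[OF sub(1)] p[OF sub(2)]
      by (simp add: near_def M_step[OF psubset.hyps v] poly_sum q)
    then show ?thesis by blast
  qed
qed

lemma near_tendsto:
  assumes "finite A"
  shows "(near V lam A \<longlongrightarrow> near V lam A 0) (at_right 0)"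
proof -
  obtain p where p: "near V lam A = (\<lambda>\<epsilon>. poly p (of_real \<epsilon>))"
    using near_poly[OF assms] by (metis ext)
  have "((\<lambda>\<epsilon>. poly p (of_real \<epsilon>)) \<longlongrightarrow> poly p (of_real 0)) (at_right 0)"
    by (intro tendsto_intros)
  then show ?thesis by (simp add: p)
qed

lemma near_bounded: "finite A \<Longrightarrow> near V lam A \<in> O[at_right 0](\<lambda>_. 1)"
  using bigoI_tendsto[of "near V lam A" "\<lambda>_. 1"] near_tendsto[of A V lam] by simp

lemma near_root:
  assumes "finite A" "near V lam A 0 = 0"
  shows "near V lam A \<in> O[at_right 0](\<lambda>\<epsilon>. of_real \<epsilon>)"
proof -
  obtain p where p: "near V lam A = (\<lambda>\<epsilon>. poly p (of_real \<epsilon>))"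
    using near_poly[OF assms(1)] by (metis ext)
  have "poly p 0 = 0" using assms(2) by (simp add: p)
  then obtain q where q: "p = [:0, 1:] * q"
    by (metis minus_zero poly_eq_0_iff_dvd dvdE)
  have "((\<lambda>\<epsilon>. poly q (of_real \<epsilon>)) \<longlongrightarrow> poly q (of_real 0)) (at_right 0)"
    by (intro tendsto_intros)
  then have "(\<lambda>\<epsilon>. poly q (of_real \<epsilon>)) \<in> O[at_right 0](\<lambda>_. 1)"
    using bigoI_tendsto[of "\<lambda>\<epsilon>. poly q (of_real \<epsilon>)" "\<lambda>_. 1"] by simp
  then have "(\<lambda>\<epsilon>. of_real \<epsilon> * poly q (of_real \<epsilon>)) \<in> O[at_right 0](\<lambda>\<epsilon>. of_real \<epsilon> * 1)"
    by (rule landau_o.big.mult_left)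
  then show ?thesis by (simp add: p q)
qed

lemma near_eq_0:
  assumes "finite A" "near V lam A \<in> O[at_right 0](\<lambda>\<epsilon>. of_real \<epsilon>)"
  shows "near V lam A 0 = 0"
proof -
  have "((\<lambda>\<epsilon>. complex_of_real \<epsilon>) \<longlongrightarrow> of_real 0) (at_right 0)" by (intro tendsto_intros)
  then have "(\<lambda>\<epsilon>. complex_of_real \<epsilon>) \<in> o[at_right 0](\<lambda>_. 1)"
    by (intro smalloI_tendsto) simp_all
  with assms(2) have "near V lam A \<in> o[at_right 0](\<lambda>_. 1)"
    by (rule landau_o.big_small_trans)
  from smalloD_tendsto[OF this] have "(near V lam A \<longlongrightarrow> 0) (at_right 0)" by simp
  then show ?thesis
    using near_tendsto[OF assms(1)] tendsto_unique[OF trivial_limit_at_right_real] by blast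
qed

lemma eventually_unit: "eventually (\<lambda>\<epsilon>. 0 < \<epsilon> \<and> \<epsilon> < (1::real)) (at_right 0)"
  using eventually_at_right_real[of 0 1] by (simp add: greaterThanLessThan_iff)

lemma near_delete_path:
  assumes "finite A" "vs \<noteq> []" "distinct vs" "set vs \<subseteq> A" "successively (\<lambda>u v. 0 < b u v) vs"
  shows "(\<lambda>\<epsilon>. of_real \<epsilon> * near V lam (A - set vs) \<epsilon>) \<in> O[at_right 0](near V lam A)"
proof (rule bigoI)
  show "\<forall>\<^sub>F \<epsilon> in at_right 0. cmod (of_real \<epsilon> * near V lam (A - set vs) \<epsilon>)
      \<le> 1 / sqrt (path_weight vs) * cmod (near V lam A \<epsilon>)"
    using eventually_unit
  proof eventually_elim
    case (elim \<epsilon>)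
    then show ?case
      using norm_delete_path_le[OF assms(1) _ _ assms(2-5), of \<epsilon> "\<lambda>v. Complex (lam - V v) \<epsilon>"]
      by (simp add: near_def norm_mult)
  qed
qed

lemma near_insert:
  assumes "finite A" "v \<in> A"
  shows "(\<lambda>\<epsilon>. of_real \<epsilon> * near V lam A \<epsilon>) \<in> O[at_right 0](near V lam (A - {v}))"
proof (rule bigoI)
  let ?K = "\<bar>lam - V v\<bar> + 1 + (\<Sum>u\<in>A - {v}. b v u)"
  show "\<forall>\<^sub>F \<epsilon> in at_right 0. cmod (of_real \<epsilon> * near V lam A \<epsilon>) \<le> ?K * cmod (near V lam (A - {v}) \<epsilon>)"
    using eventually_unit
  proof eventually_elim
    case (elim \<epsilon>)
    let ?c = "\<lambda>v. Complex (lam - V v) \<epsilon>"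
    have "\<epsilon> * cmod (M ?c A) \<le> \<epsilon> * ((cmod (?c v) + (\<Sum>u\<in>A - {v}. b v u) / \<epsilon>) * cmod (M ?c (A - {v})))"
      using elim assms by (intro mult_left_mono norm_insert_le) auto
    also have "\<dots> = (\<epsilon> * cmod (?c v) + (\<Sum>u\<in>A - {v}. b v u)) * cmod (M ?c (A - {v}))"
      using elim by (simp add: field_simps)
    also have "\<dots> \<le> ?K * cmod (M ?c (A - {v}))"
    proof (intro mult_right_mono add_right_mono norm_ge_zero)
      have "cmod (?c v) \<le> \<bar>lam - V v\<bar> + \<bar>\<epsilon>\<bar>" using cmod_le[of "?c v"] by simp
      also have "\<dots> \<le> \<bar>lam - V v\<bar> + 1" using elim by simp
      finally show "\<epsilon> * cmod (?c v) \<le> \<bar>lam - V v\<bar> + 1"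
        using elim by (meson less_imp_le mult_left_le_one_le norm_ge_zero order_trans)
    qed
    finally show ?case using elim by (simp add: near_def norm_mult)
  qed
qed

lemma near_delete_paths:
  assumes "finite A" "distinct (concat ps)" "set (concat ps) \<subseteq> A"
    and "\<And>p. p \<in> set ps \<Longrightarrow> p \<noteq> [] \<and> successively (\<lambda>u v. 0 < b u v) p"
  shows "(\<lambda>\<epsilon>. of_real \<epsilon> ^ length ps * near V lam (A - set (concat ps)) \<epsilon>) \<in> O[at_right 0](near V lam A)"
  using assms
proof (induction ps arbitrary: A)
  case Nil
  then show ?case by simp
next
  case (Cons p ps)
  have eq: "A - set (concat (p # ps)) = A - set p - set (concat ps)" by auto
  have "(\<lambda>\<epsilon>. of_real \<epsilon> ^ length ps * near V lam (A - set p - set (concat ps)) \<epsilon>)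
      \<in> O[at_right 0](near V lam (A - set p))"
    using Cons.prems by (intro Cons.IH) auto
  then have "(\<lambda>\<epsilon>. of_real \<epsilon> * (of_real \<epsilon> ^ length ps * near V lam (A - set p - set (concat ps)) \<epsilon>))
      \<in> O[at_right 0](\<lambda>\<epsilon>. of_real \<epsilon> * near V lam (A - set p) \<epsilon>)"
    by (rule landau_o.big.mult_left)
  also have "(\<lambda>\<epsilon>. of_real \<epsilon> * near V lam (A - set p) \<epsilon>) \<in> O[at_right 0](near V lam A)"
    using Cons.prems by (intro near_delete_path) auto
  finally show ?case unfolding eq length_Cons power_Suc mult.assoc .
qed

lemma near_insert_set:
  assumes "finite B" "finite A" "B \<subseteq> A"
  shows "(\<lambda>\<epsilon>. of_real \<epsilon> ^ card B * near V lam A \<epsilon>) \<in> O[at_right 0](near V lam (A - B))"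
  using assms
proof (induction B rule: finite_induct)
  case empty
  then show ?case by simp
next
  case (insert v B)
  have eq: "A - insert v B = A - B - {v}" by auto
  have "(\<lambda>\<epsilon>. of_real \<epsilon> * (of_real \<epsilon> ^ card B * near V lam A \<epsilon>))
      \<in> O[at_right 0](\<lambda>\<epsilon>. of_real \<epsilon> * near V lam (A - B) \<epsilon>)"
    using insert by (intro landau_o.big.mult_left) auto
  also have "(\<lambda>\<epsilon>. of_real \<epsilon> * near V lam (A - B) \<epsilon>) \<in> O[at_right 0](near V lam (A - B - {v}))"
    using insert by (intro near_insert) auto
  finally show ?case
    unfolding eq card_insert_disjoint[OF insert.hyps] power_Suc mult.assoc .
qed

text \<open>
  The part of \<open>F\<close> outside the sets \<open>A i\<close> is separated from them, so it only contributes a bounded factor.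
\<close>

lemma near_forest:
  assumes "finite F" "finite I" and sub: "\<And>i. i \<in> I \<Longrightarrow> A i \<subseteq> F"
    and disj: "\<And>i j. i \<in> I \<Longrightarrow> j \<in> I \<Longrightarrow> i \<noteq> j \<Longrightarrow> A i \<inter> A j = {}"
    and sep: "\<And>i u v. i \<in> I \<Longrightarrow> u \<in> A i \<Longrightarrow> v \<in> F - A i \<Longrightarrow> b u v = 0"
    and root: "\<And>i. i \<in> I \<Longrightarrow> near V lam (A i) 0 = 0"
  shows "near V lam F \<in> O[at_right 0](\<lambda>\<epsilon>. of_real \<epsilon> ^ card I)"
proof -
  define U where "U = (\<Union>i\<in>I. A i)"
  have fin: "finite (A i)" if "i \<in> I" for i using sub[OF that] assms(1) finite_subset by blast
  have U: "U \<subseteq> F" "finite U" using sub fin assms(2) by (auto simp: U_def)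
  have F: "U \<union> (F - U) = F" using U by blast
  have prod: "near V lam U = (\<lambda>\<epsilon>. \<Prod>i\<in>I. near V lam (A i) \<epsilon>)"
    unfolding near_def U_def
  proof (intro ext M_disjoint_UNION assms(2) fin disj)
    show "b u v = 0" if "i \<in> I" "j \<in> I" "i \<noteq> j" "u \<in> A i" "v \<in> A j" for i j u v
      using that sep[of i u v] sub[of j] disj[of i j] by blast
  qed
  have "M c (U \<union> (F - U)) = M c U * M c (F - U)" for c
  proof (rule M_disjoint_Un)
    show "b u v = 0" if "u \<in> U" "v \<in> F - U" for u v
      using that sep by (auto simp: U_def)
  qed (use U assms(1) in auto)
  then have "near V lam F = (\<lambda>\<epsilon>. near V lam U \<epsilon> * near V lam (F - U) \<epsilon>)"
    by (simp add: near_def F fun_eq_iff del: Un_Diff_cancel)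
  moreover have "(\<lambda>\<epsilon>. \<Prod>i\<in>I. near V lam (A i) \<epsilon>) \<in> O[at_right 0](\<lambda>\<epsilon>. \<Prod>i\<in>I. of_real \<epsilon>)"
    by (intro landau_o.big_prod near_root fin root)
  then have "(\<lambda>\<epsilon>. (\<Prod>i\<in>I. near V lam (A i) \<epsilon>) * near V lam (F - U) \<epsilon>)
      \<in> O[at_right 0](\<lambda>\<epsilon>. (\<Prod>i\<in>I. of_real \<epsilon>) * 1)"
    using assms(1) by (intro landau_o.big.mult near_bounded) auto
  ultimately show ?thesis by (simp add: prod)
qed

text \<open>
  The order of \<open>F\<close> is transported to \<open>W\<close>: the paths \<open>ps\<close> lead from \<open>F\<close> down to \<open>W \<inter> F\<close>, the part of \<open>W\<close>
  outside \<open>F\<close> and \<open>B\<close> splits off as a bounded factor, and the vertices of \<open>B \<inter> W\<close> are added one at a time.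
\<close>

lemma near_eq_0_if_few_deletions:
  assumes "finite W" "finite F" "finite B"
    and few: "card (B \<inter> W) + length ps < k"
    and F: "near V lam F \<in> O[at_right 0](\<lambda>\<epsilon>. of_real \<epsilon> ^ k)"
    and sep: "\<And>u v. u \<in> W \<inter> F \<Longrightarrow> v \<in> W - F - B \<Longrightarrow> b u v = 0" and B: "B \<inter> F = {}"
    and ps: "set (concat ps) = F - W" "distinct (concat ps)"
      "\<And>p. p \<in> set ps \<Longrightarrow> p \<noteq> [] \<and> successively (\<lambda>u v. 0 < b u v) p"
  shows "near V lam W 0 = 0"
proof -
  define n where "n = card (B \<inter> W)"
  have "M c ((W \<inter> F) \<union> (W - F - B)) = M c (W \<inter> F) * M c (W - F - B)" for c
    by (rule M_disjoint_Un) (use assms(1,2) sep in auto)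
  moreover have "(W \<inter> F) \<union> (W - F - B) = W - B \<inter> W" using B by blast
  ultimately have split: "near V lam (W - B \<inter> W) = (\<lambda>\<epsilon>. near V lam (W \<inter> F) \<epsilon> * near V lam (W - F - B) \<epsilon>)"
    by (simp add: near_def fun_eq_iff)
  have "(\<lambda>\<epsilon>. of_real \<epsilon> ^ n * near V lam W \<epsilon>) \<in> O[at_right 0](near V lam (W - B \<inter> W))"
    unfolding n_def using assms(1,3) by (intro near_insert_set) auto
  also have "near V lam (W - B \<inter> W) \<in> O[at_right 0](\<lambda>\<epsilon>. near V lam (W \<inter> F) \<epsilon> * 1)"
    unfolding split using assms(1) by (intro landau_o.big.mult_left near_bounded) auto
  finally have "(\<lambda>\<epsilon>. of_real \<epsilon> ^ length ps * (of_real \<epsilon> ^ n * near V lam W \<epsilon>))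
      \<in> O[at_right 0](\<lambda>\<epsilon>. of_real \<epsilon> ^ length ps * near V lam (W \<inter> F) \<epsilon>)"
    by (intro landau_o.big.mult_left) simp
  also have "F - (F - W) = W \<inter> F" by blast
  then have "(\<lambda>\<epsilon>. of_real \<epsilon> ^ length ps * near V lam (W \<inter> F) \<epsilon>) \<in> O[at_right 0](near V lam F)"
    using near_delete_paths[OF assms(2) ps(2) _ ps(3), of V lam] ps(1) by simp
  also note F
  also have "(\<lambda>\<epsilon>. of_real \<epsilon> ^ k) \<in> O[at_right 0](\<lambda>\<epsilon>. complex_of_real \<epsilon> ^ Suc (n + length ps))"
  proof (rule bigoI)
    show "\<forall>\<^sub>F \<epsilon> in at_right 0. cmod (of_real \<epsilon> ^ k) \<le> 1 * cmod (of_real \<epsilon> ^ Suc (n + length ps))"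
      using eventually_unit
    proof eventually_elim
      case (elim \<epsilon>)
      have "\<epsilon> ^ k \<le> \<epsilon> ^ Suc (n + length ps)"
        using elim few by (intro power_decreasing) (auto simp: n_def)
      then show ?case using elim by (simp add: norm_power norm_mult)
    qed
  qed
  finally have big: "(\<lambda>\<epsilon>. of_real \<epsilon> ^ (n + length ps) * near V lam W \<epsilon>)
      \<in> O[at_right 0](\<lambda>\<epsilon>. of_real \<epsilon> ^ (n + length ps) * of_real \<epsilon>)"
    by (simp add: power_add mult_ac)
  have nz: "\<forall>\<^sub>F \<epsilon> in at_right 0. complex_of_real \<epsilon> ^ (n + length ps) \<noteq> 0"
    using eventually_unit by eventually_elim simp
  have "near V lam W \<in> O[at_right 0](\<lambda>\<epsilon>. of_real \<epsilon>)"
    using big by (rule iffD1[OF landau_o.big.mult_cancel_left[OF bigtheta_refl nz]])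
  then show ?thesis using near_eq_0[OF assms(1)] by blast
qed

end

section \<open>The matching polynomial of a multigraph\<close>

locale weighted_multigraph = finite_multigraph +
  fixes w :: "'b \<Rightarrow> complex"
  assumes w: "schroedinger_data G arev w"
begin

lemma w_nz: "e \<in> arcs G \<Longrightarrow> w e \<noteq> 0"
  using w unfolding schroedinger_data_def by blast

lemma w_arev: "e \<in> arcs G \<Longrightarrow> w (arev e) = cnj (w e)"
proof -
  assume "e \<in> arcs G"
  then have "w e = cnj (w (arev e))" using w unfolding schroedinger_data_def by blast
  then have "cnj (w e) = w (arev e)" by simp
  then show ?thesis by simp
qed

text \<open>
  A matching is determined by its arc set, since its vertices are the origins of its arcs. Injectivity of the
  origin says that all degrees are 1; it excludes self-loops, both of whose orientations have the same
  origin.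
\<close>

definition matching_arcs :: "'a set \<Rightarrow> 'b set set" where
  "matching_arcs A = {X. X \<subseteq> arcs G \<and> tail G ` X \<subseteq> A \<and> arev ` X \<subseteq> X \<and> inj_on (tail G) X}"

definition matching_term :: "('a \<Rightarrow> complex) \<Rightarrow> 'a set \<Rightarrow> 'b set \<Rightarrow> complex" where
  "matching_term c A X =
     (-1) ^ (card X div 2) * (\<Prod>e\<in>X. w e) * (\<Prod>u\<in>A - tail G ` X. c u)"

definition matching_sum :: "('a \<Rightarrow> complex) \<Rightarrow> 'a set \<Rightarrow> complex" where
  "matching_sum c A = (\<Sum>X\<in>matching_arcs A. matching_term c A X)"

definition edge_weight :: "'a \<Rightarrow> 'a \<Rightarrow> real" where
  "edge_weight v u = (\<Sum>e\<in>{e \<in> arcs G. tail G e = v \<and> head G e = u}. (cmod (w e))\<^sup>2)"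

lemma finite_matching_arcs: "finite (matching_arcs A)"
  by (rule finite_subset[of _ "Pow (arcs G)"]) (auto simp: matching_arcs_def)

lemma matching_arcsD:
  assumes "X \<in> matching_arcs A"
  shows "X \<subseteq> arcs G" "finite X" "tail G ` X \<subseteq> A" "e \<in> X \<Longrightarrow> arev e \<in> X" "inj_on (tail G) X"
  using assms finite_subset[OF _ finite_arcs] by (auto simp: matching_arcs_def)

lemma matching_arcs_head:
  assumes "X \<in> matching_arcs A" "e \<in> X"
  shows "head G e \<in> A" "head G e \<noteq> tail G e"
proof -
  note X = matching_arcsD[OF assms(1)]
  have e: "e \<in> arcs G" "arev e \<in> X" using X(1,4) assms(2) by auto
  then have "head G e = tail G (arev e)" by simp
  then show "head G e \<in> A" using e X(3) by auto
  show "head G e \<noteq> tail G e"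
    using e assms(2) arev_neq[OF e(1)] inj_onD[OF X(5), of "arev e" e] by auto
qed

lemma matching_arcs_delete:
  assumes "X \<in> matching_arcs A" "e \<in> X"
  shows "X - {e, arev e} \<in> matching_arcs (A - {tail G e} - {head G e})"
proof -
  note X = matching_arcsD[OF assms(1)]
  have e: "e \<in> arcs G" "arev e \<in> X" using X(1,4) assms(2) by auto
  have "tail G f \<noteq> tail G e" "tail G f \<noteq> head G e" if "f \<in> X - {e, arev e}" for f
    using that inj_onD[OF X(5), of f e] inj_onD[OF X(5), of f "arev e"] e assms(2) by auto
  moreover have "arev f \<in> X - {e, arev e}" if "f \<in> X - {e, arev e}" for f
    using that X(4)[of f] by (auto simp: arev_eq_iff)
  ultimately show ?thesis
    using X by (auto simp: matching_arcs_def intro: inj_on_subset)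
qed

lemma matching_arcs_insert:
  assumes "Y \<in> matching_arcs (A - {tail G e} - {head G e})" "e \<in> arcs G"
    and "tail G e \<in> A" "head G e \<in> A" "head G e \<noteq> tail G e"
  shows "insert e (insert (arev e) Y) \<in> matching_arcs A" "e \<notin> Y" "arev e \<notin> Y"
proof -
  note Y = matching_arcsD[OF assms(1)]
  show notin: "e \<notin> Y" "arev e \<notin> Y" using Y(3) assms(2) by fastforce+
  have "tail G e \<notin> tail G ` Y" "head G e \<notin> tail G ` Y" using Y(3) by auto
  then show "insert e (insert (arev e) Y) \<in> matching_arcs A"
    using Y assms(2-) by (auto simp: matching_arcs_def)
qed

lemma matching_term_insert:
  assumes "Y \<in> matching_arcs (A - {tail G e} - {head G e})" "e \<in> arcs G"
    and "tail G e \<in> A" "head G e \<in> A" "head G e \<noteq> tail G e"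
  shows "matching_term c A (insert e (insert (arev e) Y))
    = - (of_real ((cmod (w e))\<^sup>2) * matching_term c (A - {tail G e} - {head G e}) Y)"
proof -
  have fin: "finite Y" using matching_arcsD(2)[OF assms(1)] .
  have new: "e \<notin> insert (arev e) Y" "arev e \<notin> Y"
    using matching_arcs_insert(2,3)[OF assms] arev_neq[OF assms(2)] by auto
  have "A - tail G ` insert e (insert (arev e) Y) = A - {tail G e} - {head G e} - tail G ` Y"
    using assms(2) by auto
  moreover have "card (insert e (insert (arev e) Y)) div 2 = Suc (card Y div 2)"
    using fin new by simp
  moreover have "w e * w (arev e) = of_real ((cmod (w e))\<^sup>2)"
    using complex_norm_square[of "w e"] by (simp add: w_arev[OF assms(2)])
  ultimately show ?thesis
    using fin new by (simp add: matching_term_def mult.assoc[symmetric])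
qed

text \<open>
  Matchings that miss \<open>v\<close> give the first term. A matching that covers \<open>v\<close> is the unique arc \<open>e\<close> leaving
  \<open>v\<close>, its reverse, and a matching avoiding both endpoints; the two arcs contribute
  \<open>w\<^sub>e * cnj w\<^sub>e = \<bar>w\<^sub>e\<bar>\<^sup>2\<close> and one sign.
\<close>

lemma matching_sum_step:
  assumes A: "finite A" and v: "v \<in> A"
  shows "matching_sum c A = c v * matching_sum c (A - {v})
    - (\<Sum>u\<in>A - {v}. of_real (edge_weight v u) * matching_sum c (A - {v} - {u}))"
proof -
  let ?in = "{X \<in> matching_arcs A. v \<in> tail G ` X}"
  let ?E = "{e \<in> arcs G. tail G e = v \<and> head G e \<in> A - {v}}"
  let ?m = "\<lambda>e. matching_arcs (A - {v} - {head G e})"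
  have finE: "finite ?E" by simp
  have out: "matching_arcs A - ?in = matching_arcs (A - {v})"
    by (auto simp: matching_arcs_def)
  have "(\<Sum>X\<in>matching_arcs (A - {v}). matching_term c A X) = c v * matching_sum c (A - {v})"
    unfolding matching_sum_def sum_distrib_left
  proof (rule sum.cong[OF refl])
    fix X assume X: "X \<in> matching_arcs (A - {v})"
    have "A - tail G ` X = insert v (A - {v} - tail G ` X)"
      using matching_arcsD(3)[OF X] v by auto
    then show "matching_term c A X = c v * matching_term c (A - {v}) X"
      using A by (simp add: matching_term_def)
  qed
  moreover have "(\<Sum>X\<in>?in. matching_term c A X)
      = (\<Sum>(e, Y)\<in>Sigma ?E ?m. - (of_real ((cmod (w e))\<^sup>2) * matching_term c (A - {v} - {head G e}) Y))"
  proof -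
    let ?e = "\<lambda>X. SOME e. e \<in> X \<and> tail G e = v"
    let ?i = "\<lambda>(e, Y). insert e (insert (arev e) Y)" and ?j = "\<lambda>X. (?e X, X - {?e X, arev (?e X)})"
    have e: "?e X \<in> X \<and> tail G (?e X) = v" if "X \<in> ?in" for X
      by (rule someI_ex) (use that in auto)
    have j: "?j X \<in> Sigma ?E ?m" and ij: "?i (?j X) = X" if X: "X \<in> ?in" for X
    proof -
      have X': "X \<in> matching_arcs A" using X by simp
      note e = e[OF X]
      show "?j X \<in> Sigma ?E ?m"
        using matching_arcsD(1)[OF X'] matching_arcs_head[OF X', of "?e X"]
          matching_arcs_delete[OF X', of "?e X"] e by auto
      show "?i (?j X) = X" using e matching_arcsD(4)[OF X', of "?e X"] by auto
    qed
    have i: "?i p \<in> ?in" and ji: "?j (?i p) = p"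
      and val:
        "(case p of (e, Y) \<Rightarrow> - (of_real ((cmod (w e))\<^sup>2) * matching_term c (A - {v} - {head G e}) Y))
        = matching_term c A (?i p)" if p: "p \<in> Sigma ?E ?m" for p
    proof -
      obtain e' Y where p': "p = (e', Y)" and eY: "e' \<in> ?E" "Y \<in> ?m e'" using p by auto
      have eY': "Y \<in> matching_arcs (A - {tail G e'} - {head G e'})" "e' \<in> arcs G" "tail G e' \<in> A"
        "head G e' \<in> A" "head G e' \<noteq> tail G e'"
        using eY v by auto
      note ins = matching_arcs_insert[OF eY']
      show i: "?i p \<in> ?in" using ins(1) eY by (auto simp: p')
      have "?i p \<in> matching_arcs A" using i by simp
      from matching_arcsD(5)[OF this] have "?e (?i p) = e'"
        using e[OF i] eY by (intro inj_onD[of "tail G" "?i p"]) (auto simp: p')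
      then show "?j (?i p) = p" using ins(2,3) by (auto simp: p')
      show "(case p of (e, Y) \<Rightarrow> - (of_real ((cmod (w e))\<^sup>2) * matching_term c (A - {v} - {head G e}) Y))
          = matching_term c A (?i p)"
        using matching_term_insert[OF eY', of c] eY by (simp add: p')
    qed
    show ?thesis
    proof (rule sum.reindex_bij_witness[where i = ?i and j = ?j])
      fix X assume X: "X \<in> ?in"
      show "?i (?j X) = X" by (rule ij[OF X])
      show "?j X \<in> Sigma ?E ?m" by (rule j[OF X])
      from val[OF this]
      show "(case ?j X of (e, Y) \<Rightarrow> - (of_real ((cmod (w e))\<^sup>2) * matching_term c (A - {v} - {head G e}) Y))
          = matching_term c A X"
        by (simp only: ij[OF X])
    next
      fix p assume p: "p \<in> Sigma ?E ?m"
      show "?j (?i p) = p" by (rule ji[OF p])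
      show "?i p \<in> ?in" by (rule i[OF p])
    qed
  qed
  moreover have "\<dots> = - (\<Sum>e\<in>?E. of_real ((cmod (w e))\<^sup>2) * matching_sum c (A - {v} - {head G e}))"
    by (subst sum.Sigma[symmetric])
      (auto simp: finite_matching_arcs sum_negf sum_distrib_left matching_sum_def)
  moreover have "(\<Sum>e\<in>?E. of_real ((cmod (w e))\<^sup>2) * matching_sum c (A - {v} - {head G e}))
     = (\<Sum>u\<in>A - {v}. of_real (edge_weight v u) * matching_sum c (A - {v} - {u}))"
  proof -
    have "(\<Sum>u\<in>A - {v}. \<Sum>e\<in>{e \<in> ?E. head G e = u}. of_real ((cmod (w e))\<^sup>2) * matching_sum c (A - {v} - {head G e}))
      = (\<Sum>e\<in>?E. of_real ((cmod (w e))\<^sup>2) * matching_sum c (A - {v} - {head G e}))"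
      using A by (intro sum.group) auto
    moreover have "(\<Sum>e\<in>{e \<in> ?E. head G e = u}. of_real ((cmod (w e))\<^sup>2) * matching_sum c (A - {v} - {head G e}))
      = of_real (edge_weight v u) * matching_sum c (A - {v} - {u})" if "u \<in> A - {v}" for u
    proof -
      have "{e \<in> ?E. head G e = u} = {e \<in> arcs G. tail G e = v \<and> head G e = u}" using that by auto
      then show ?thesis by (simp add: edge_weight_def sum_distrib_right)
    qed
    ultimately show ?thesis by simp
  qed
  moreover have "matching_sum c A
      = (\<Sum>X\<in>matching_arcs A - ?in. matching_term c A X) + (\<Sum>X\<in>?in. matching_term c A X)"
    unfolding matching_sum_def using finite_matching_arcs by (intro sum.subset_diff) auto
  ultimately show ?thesis by (simp add: out)
qed

sublocale matching_recurrence edge_weight matching_sum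
proof
  show "0 \<le> edge_weight u v" for u v by (auto simp: edge_weight_def intro: sum_nonneg)
  show "matching_sum c {} = 1" for c
  proof -
    have "matching_arcs {} = {{}}" by (auto simp: matching_arcs_def)
    then show ?thesis by (simp add: matching_sum_def matching_term_def)
  qed
qed (rule matching_sum_step)

lemma poly_matching_poly:
  assumes "A \<subseteq> verts G"
  shows "poly (matching_poly arev w V (G \<restriction> A)) x = matching_sum (\<lambda>u. x - of_real (V u)) A"
proof -
  let ?M = "\<lambda>X. \<lparr>verts = tail G ` X, arcs = X, tail = tail G, head = head G\<rparr>"
  have finA: "finite A" using assms finite_verts by (rule finite_subset)
  have sub: "wf_digraph (G \<restriction> A)" by (rule wellformed_induce_subgraph)
  have deg: "(\<forall>v\<in>tail G ` X. card {e \<in> X. tail G e = v} = 1) \<longleftrightarrow> inj_on (tail G) X" for X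
  proof
    assume L: "\<forall>v\<in>tail G ` X. card {e \<in> X. tail G e = v} = 1"
    show "inj_on (tail G) X"
    proof (rule inj_onI)
      fix e f assume "e \<in> X" "f \<in> X" "tail G e = tail G f"
      moreover from L this obtain g where "{d \<in> X. tail G d = tail G e} = {g}"
        by (auto simp: card_1_singleton_iff)
      ultimately show "e = f" by (metis (mono_tags, lifting) mem_Collect_eq singletonD)
    qed
  next
    assume "inj_on (tail G) X"
    then have "{e \<in> X. tail G e = tail G f} = {f}" if "f \<in> X" for f
      using that by (auto dest: inj_onD)
    then show "\<forall>v\<in>tail G ` X. card {e \<in> X. tail G e = v} = 1" by auto
  qed
  have M_in: "?M X \<in> matchings arev (G \<restriction> A)" if X: "X \<in> matching_arcs A" for X
  proof -
    have "wf_digraph (?M X)"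
    proof
      fix e assume "e \<in> arcs (?M X)"
      then have "e \<in> X" by simp
      then have "arev e \<in> X" "e \<in> arcs G" using matching_arcsD[OF X] by auto
      then have "head G e \<in> tail G ` X" by (metis image_eqI tail_arev)
      then show "head (?M X) e \<in> verts (?M X)" by simp
    qed auto
    then have "subgraph (?M X) (G \<restriction> A)"
      using matching_arcsD[OF X] matching_arcs_head[OF X] sub
      by (auto simp: subgraph_def compatible_def)
    then show ?thesis
      using deg[of X] matching_arcsD[OF X]
      by (simp add: matchings_def degree_subgraph_def multi_subgraph_def out_degree_def out_arcs_def)
  qed
  have M_out: "arcs M \<in> matching_arcs A \<and> M = ?M (arcs M)" if "M \<in> matchings arev (G \<restriction> A)" for M
  proof -
    have sg: "subgraph M (G \<restriction> A)" and rev: "\<forall>e\<in>arcs M. arev e \<in> arcs M"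
      and deg1: "\<forall>v\<in>verts M. out_degree M v = 1"
      using that by (auto simp: matchings_def degree_subgraph_def multi_subgraph_def)
    interpret M: wf_digraph M using sg by auto
    have th: "tail M = tail G" "head M = head G" using sg by (auto simp: subgraph_def compatible_def)
    have arcs: "arcs M \<subseteq> arcs G" "verts M \<subseteq> A" using sg by (auto simp: subgraph_def)
    have "v \<in> tail G ` arcs M" if "v \<in> verts M" for v
    proof -
      have "out_arcs M v \<noteq> {}" using deg1 that by (auto simp: out_degree_def)
      then show ?thesis by (auto simp: out_arcs_def th)
    qed
    then have verts: "verts M = tail G ` arcs M" using M.tail_in_verts by (auto simp: th)
    have "inj_on (tail G) (arcs M)"
      using deg1 deg[of "arcs M"] by (simp add: verts out_degree_def out_arcs_def th)
    then have "arcs M \<in> matching_arcs A"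
      using arcs rev by (auto simp: matching_arcs_def verts)
    moreover have "M = ?M (arcs M)" using verts th by (cases M) simp
    ultimately show ?thesis by blast
  qed
  have "poly (matching_poly arev w V (G \<restriction> A)) x
    = (\<Sum>M\<in>matchings arev (G \<restriction> A). (-1) ^ (card (verts M) div 2) * (\<Prod>e\<in>arcs M. w e)
        * (\<Prod>u\<in>A - verts M. x - of_real (V u)))"
    by (simp add: matching_poly_def poly_sum poly_prod)
  also have "\<dots> = matching_sum (\<lambda>u. x - of_real (V u)) A"
    unfolding matching_sum_def
  proof (rule sum.reindex_bij_witness[of _ ?M arcs])
    fix X assume X: "X \<in> matching_arcs A"
    show "?M X \<in> matchings arev (G \<restriction> A)" by (rule M_in[OF X])
    show "arcs (?M X) = X" by simp
  next
    fix M assume M: "M \<in> matchings arev (G \<restriction> A)"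
    then show "?M (arcs M) = M" "arcs M \<in> matching_arcs A" using M_out by simp_all
    have verts: "verts M = tail G ` arcs M" using M_out[OF M] by (metis pre_digraph.select_convs(1))
    have "card (verts M) = card (arcs M)"
      unfolding verts using M_out[OF M] matching_arcsD(5) card_image by blast
    then show "matching_term (\<lambda>u. x - of_real (V u)) A (arcs M)
        = (-1) ^ (card (verts M) div 2) * (\<Prod>e\<in>arcs M. w e) * (\<Prod>u\<in>A - verts M. x - of_real (V u))"
      by (simp add: matching_term_def verts[symmetric])
  qed
  finally show ?thesis .
qed

lemma poly_matching_poly_near:
  assumes "A \<subseteq> verts G"
  shows "poly (matching_poly arev w V (G \<restriction> A)) (of_real lam) = near V lam A 0"
  by (simp add: poly_matching_poly[OF assms] near_def complex_of_real_def[symmetric] flip: of_real_diff)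

end

section \<open>Leaves and path covers in forests\<close>

context finite_multigraph
begin

lemma apath_no_backtrack:
  assumes "apath u p v" "f \<in> set p"
  shows "arev f \<notin> set p"
proof -
  have first: "arev e \<notin> set es" if "apath u (e # es) v" for u e es
  proof
    assume "arev e \<in> set es"
    moreover from that have "awalk (head G e) es v" "e \<in> arcs G"
      by (auto simp: apath_Cons_iff intro: awalkI_apath)
    ultimately have "head G (arev e) \<in> set (awalk_verts (head G e) es)"
      by (intro awalk_verts_arc2)
    with that \<open>e \<in> arcs G\<close> show False by (auto simp: apath_Cons_iff)
  qed
  show ?thesis
    using assms
  proof (induction p arbitrary: u)
    case (Cons e es)
    have e: "e \<in> arcs G" "apath (head G e) es v" using Cons.prems by (auto simp: apath_Cons_iff)
    show ?case
    proof (cases "f = e")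
      case True
      then show ?thesis using first[OF Cons.prems(1)] arev_neq[OF e(1)] by simp
    next
      case False
      then have "f \<in> set es" using Cons.prems(2) by simp
      then have "arev f \<notin> set es" by (rule Cons.IH[OF e(2)])
      moreover have "arev f \<noteq> e" using \<open>f \<in> set es\<close> first[OF Cons.prems(1)] by auto
      ultimately show ?thesis by simp
    qed
  qed simp
qed

definition arcs_into :: "'a set \<Rightarrow> 'a \<Rightarrow> 'b set" where
  "arcs_into B v = {e \<in> arcs G. tail G e = v \<and> head G e \<in> B}"

text \<open>
  Take a longest path inside \<open>B\<close>. If its initial vertex has a second arc into \<open>B\<close>, other than the
  first arc of the path, that arc leads back to the path by maximality and closes a cycle that does
  not run through any edge in both directions.
\<close>

lemma acyclic_imp_leaf:
  assumes acyc: "acyclic_multigraph arev (G \<restriction> S)" and S: "S \<subseteq> verts G"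
    and B: "B \<subseteq> S" "B \<noteq> {}"
  shows "\<exists>v\<in>B. card (arcs_into B v) \<le> 1"
proof (rule ccontr)
  assume "\<not> ?thesis"
  then have many: "2 \<le> card (arcs_into B v)" if "v \<in> B" for v using that by auto
  interpret K: wf_digraph "G \<restriction> S" by (rule wellformed_induce_subgraph)
  have sub: "subgraph (G \<restriction> S) G" using S by (rule subgraph_induce_subgraphI)
  define P where "P p \<longleftrightarrow> (\<exists>u v. K.apath u p v \<and> set (K.awalk_verts u p) \<subseteq> B)" for p
  have finB: "finite B" by (rule finite_subset[OF subset_trans[OF B(1) S] finite_verts])
  have "P []" using B by (auto simp: P_def K.apath_Nil_iff)
  moreover have "length p < Suc (card B)" if "P p" for p
  proof -
    from that obtain u v where "K.apath u p v" "set (K.awalk_verts u p) \<subseteq> B" by (auto simp: P_def)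
    then have "length (K.awalk_verts u p) \<le> card B"
      using finB by (metis K.apath_def card_mono distinct_card)
    then show ?thesis by (simp add: K.length_awalk_verts)
  qed
  ultimately obtain p where "P p" and longest: "\<And>q. P q \<Longrightarrow> length q \<le> length p"
    using ex_has_greatest_nat[of P "[]" length "Suc (card B)"] by blast
  from \<open>P p\<close> obtain u v where p: "K.apath u p v" and pB: "set (K.awalk_verts u p) \<subseteq> B"
    by (auto simp: P_def)
  have u: "u \<in> B" using p pB K.hd_in_awalk_verts(2) by blast
  have "\<exists>e\<in>arcs_into B u. p \<noteq> [] \<longrightarrow> e \<noteq> hd p"
  proof (rule ccontr)
    assume "\<not> ?thesis"
    then have "arcs_into B u \<subseteq> {hd p}" by auto
    from card_mono[OF _ this] many[OF u] show False by simp
  qed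
  then obtain e where e: "e \<in> arcs G" "tail G e = u" "head G e \<in> B" and hd: "p \<noteq> [] \<Longrightarrow> e \<noteq> hd p"
    by (auto simp: arcs_into_def)
  let ?x = "head G e"
  have rev: "arev e \<in> arcs (G \<restriction> S)" "tail G (arev e) = ?x" "head G (arev e) = u"
    using e u B by auto
  have "?x \<in> set (K.awalk_verts u p)"
  proof (rule ccontr)
    assume "?x \<notin> set (K.awalk_verts u p)"
    then have "P (arev e # p)"
      unfolding P_def using p pB rev e
      by (intro exI[of _ ?x] exI[of _ v]) (simp add: K.apath_Cons_iff)
    from longest[OF this] show False by simp
  qed
  then obtain q r where qr: "p = q @ r" "K.awalk u q ?x"
    using K.awalk_decomp[OF K.awalkI_apath[OF p]] by blast
  have q: "K.apath u q ?x"
    using p qr by (simp add: K.apath_append_iff)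
  have "K.cycle (arev e # q)"
    unfolding K.cycle_def using qr(2) q rev
    by (intro exI[of _ ?x]) (simp add: K.awalk_Cons_iff K.apath_def)
  moreover have "arev f \<notin> set (arev e # q)" if f: "f \<in> set (arev e # q)" for f
  proof -
    have "e \<notin> set q"
    proof
      assume eq: "e \<in> set q"
      then obtain g q' where g: "q = g # q'" by (cases q) auto
      have "e \<noteq> g" using hd qr(1) g by auto
      then have "tail G e \<in> set (K.awalk_verts (head G g) q')"
        using eq g K.awalk_verts_arc1[of e q'] by simp
      then show False using q g e(2) by (auto simp: K.apath_Cons_iff)
    qed
    moreover have "apath u q ?x" by (rule subgraph_apath_imp_apath[OF q sub])
    then have "arev g \<notin> set q" if "g \<in> set q" for g using apath_no_backtrack that by blast
    ultimately show ?thesis using f arev_neq[OF e(1)] by (auto simp: arev_eq_iff)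
  qed
  ultimately show False using acyc by (auto simp: acyclic_multigraph_def)
qed

text \<open>
  A graph of maximal degree 2 without cycles is a disjoint union of paths, and the number of paths
  is the number of vertices minus the number of edges (here \<open>\<Gamma>\<close> counts both orientations, whence the factors 2).
  A leaf \<open>v\<close> of the surrounding forest is removed first; its neighbour \<open>u\<close> in \<open>\<Gamma>\<close>, if any, must be an
  end of its path, because an interior vertex already has two neighbours besides \<open>v\<close>.
\<close>

lemma path_cover:
  assumes "finite D" and leaf: "\<And>B. B \<subseteq> D \<Longrightarrow> B \<noteq> {} \<Longrightarrow> \<exists>v\<in>B. card (arcs_into B v) \<le> 1"
    and \<Gamma>: "\<Gamma> \<subseteq> arcs G" "\<And>e. e \<in> \<Gamma> \<Longrightarrow> arev e \<in> \<Gamma>"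
    and deg: "\<And>v. v \<in> D \<Longrightarrow> card {e \<in> \<Gamma>. tail G e = v} \<le> 2"
  shows "\<exists>ps. distinct (concat ps) \<and> set (concat ps) = D \<and>
    (\<forall>p\<in>set ps. p \<noteq> [] \<and> successively (\<lambda>u v. \<exists>e\<in>\<Gamma>. tail G e = u \<and> head G e = v) p) \<and>
    2 * length ps + card {e \<in> \<Gamma>. tail G e \<in> D \<and> head G e \<in> D} \<le> 2 * card D"
  using assms(1,2,5)
proof (induction D rule: finite_psubset_induct)
  case (psubset D)
  let ?adj = "\<lambda>u v. \<exists>e\<in>\<Gamma>. tail G e = u \<and> head G e = v"
  let ?X = "\<lambda>D. {e \<in> \<Gamma>. tail G e \<in> D \<and> head G e \<in> D}"
  have fin\<Gamma>: "finite {e \<in> \<Gamma>. Q e}" for Q using \<Gamma>(1) finite_subset[OF _ finite_arcs] by auto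
  have adj_sym: "?adj v u" if "?adj u v" for u v
  proof -
    from that obtain e where "e \<in> \<Gamma>" "tail G e = u" "head G e = v" by blast
    then show ?thesis using \<Gamma> by (intro bexI[of _ "arev e"]) auto
  qed
  show ?case
  proof (cases "D = {}")
    case True
    then show ?thesis by (intro exI[of _ "[]"]) simp
  next
    case False
    then obtain v where v: "v \<in> D" and leaf: "card (arcs_into D v) \<le> 1"
      using psubset.prems(1)[of D] by blast
    have fin: "finite D" by (rule psubset.hyps)
    have cardD: "card D = Suc (card (D - {v}))" using fin v by (rule card.remove)
    have "\<exists>ps. distinct (concat ps) \<and> set (concat ps) = D - {v} \<and>
      (\<forall>p\<in>set ps. p \<noteq> [] \<and> successively ?adj p) \<and>
      2 * length ps + card (?X (D - {v})) \<le> 2 * card (D - {v})"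
    proof (rule psubset.IH)
      show "\<exists>v\<in>B. card (arcs_into B v) \<le> 1" if "B \<subseteq> D - {v}" "B \<noteq> {}" for B
        using that by (intro psubset.prems(1)) auto
      show "card {e \<in> \<Gamma>. tail G e = x} \<le> 2" if "x \<in> D - {v}" for x
        using that by (intro psubset.prems(2)) auto
    qed (use v in blast)
    then obtain ps where ps: "distinct (concat ps)" "set (concat ps) = D - {v}"
      "\<And>p. p \<in> set ps \<Longrightarrow> p \<noteq> [] \<and> successively ?adj p"
      "2 * length ps + card (?X (D - {v})) \<le> 2 * card (D - {v})" by blast
    then have count: "2 * length ps + card (?X (D - {v})) + 2 \<le> 2 * card D"
      using cardD by linarith
    show ?thesis
    proof (cases "\<exists>u\<in>D. ?adj v u")
      case False
      have "?X D = ?X (D - {v})"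
        using False adj_sym by blast
      then have "2 * length ([v] # ps) + card (?X D) \<le> 2 * card D"
        using count by simp
      then show ?thesis
        using ps(1-3) v by (intro exI[of _ "[v] # ps"]) auto
    next
      case True
      then obtain e where e: "e \<in> \<Gamma>" "tail G e = v" "head G e \<in> D" by blast
      define u where "u = head G e"
      have eG: "e \<in> arcs G" using e \<Gamma> by blast
      have fin_out: "finite (arcs_into D v)" by (simp add: arcs_into_def)
      have "e \<in> arcs_into D v" using e eG by (simp add: arcs_into_def)
      then have out: "f = e" if "f \<in> arcs_into D v" for f
        using that leaf fin_out by (metis One_nat_def card_le_Suc0_iff_eq)
      have "u \<noteq> v"
      proof
        assume "u = v"
        then have "arev e \<in> arcs_into D v" using e eG by (simp add: arcs_into_def u_def)
        from out[OF this] show False using arev_neq[OF eG] by simp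
      qed
      have "?X D \<subseteq> insert e (insert (arev e) (?X (D - {v})))"
      proof
        fix f assume f: "f \<in> ?X D"
        show "f \<in> insert e (insert (arev e) (?X (D - {v})))"
        proof (cases "tail G f = v \<or> head G f = v")
          case True
          then have "f \<in> arcs_into D v \<or> arev f \<in> arcs_into D v" using f \<Gamma> by (auto simp: arcs_into_def)
          then have "f = e \<or> arev f = e" using out by blast
          then show ?thesis by auto
        qed (use f in auto)
      qed
      then have "card (?X D) \<le> card (insert e (insert (arev e) (?X (D - {v}))))"
        using fin\<Gamma> by (intro card_mono) auto
      also have "\<dots> \<le> card (?X (D - {v})) + 2"
        using fin\<Gamma> by (simp add: card_insert_if)
      finally have cardX: "card (?X D) \<le> card (?X (D - {v})) + 2" .
      have uv: "?adj u v" "?adj v u" using e adj_sym by (auto simp: u_def)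
      have "u \<in> set (concat ps)" using ps(2) e \<open>u \<noteq> v\<close> by (simp add: u_def)
      then obtain p where p: "p \<in> set ps" "u \<in> set p" by auto
      then obtain as bs where asbs: "ps = as @ p # bs" by (meson split_list)
      have "hd p = u \<or> last p = u"
      proof (rule ccontr)
        assume no: "\<not> ?thesis"
        obtain xs ys where xy: "p = xs @ u # ys" using p(2) by (meson split_list)
        have "xs \<noteq> []" "ys \<noteq> []" using no xy by auto
        then obtain xs' a b ys' where ab: "xs = xs' @ [a]" "ys = b # ys'"
          by (metis append_butlast_last_id neq_Nil_conv)
        have "?adj a u" "?adj u b"
          using ps(3)[OF p(1)] by (auto simp: xy ab successively_append_iff)
        then have "?adj u a" using adj_sym by blast
        have "distinct p" using ps(1) asbs by simp
        then have "a \<noteq> b" by (auto simp: xy ab)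
        have "v \<notin> set p" using ps(2) p(1) by auto
        then have "v \<noteq> a" "v \<noteq> b" by (auto simp: xy ab)
        obtain fa where fa: "fa \<in> \<Gamma>" "tail G fa = u" "head G fa = a" using \<open>?adj u a\<close> by blast
        obtain fb where fb: "fb \<in> \<Gamma>" "tail G fb = u" "head G fb = b" using \<open>?adj u b\<close> by blast
        obtain fv where fv: "fv \<in> \<Gamma>" "tail G fv = u" "head G fv = v" using uv(1) by blast
        have "card {fa, fb, fv} = 3"
          using fa fb fv \<open>a \<noteq> b\<close> \<open>v \<noteq> a\<close> \<open>v \<noteq> b\<close> by (auto simp: card_insert_if)
        moreover have "card {fa, fb, fv} \<le> card {f \<in> \<Gamma>. tail G f = u}"
          using fa fb fv fin\<Gamma> by (intro card_mono) auto
        ultimately show False using psubset.prems(2)[of u] e by (simp add: u_def)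
      qed
      define p' where "p' = (if hd p = u then v # p else p @ [v])"
      have p': "p' \<noteq> []" "set p' = insert v (set p)" "successively ?adj p'"
        using ps(3)[OF p(1)] uv \<open>hd p = u \<or> last p = u\<close>
        by (auto simp: p'_def successively_Cons successively_append_iff)
      have "v \<notin> set (concat ps)" using ps(2) by simp
      then have "distinct (concat (as @ p' # bs))"
        using ps(1) by (auto simp: asbs p'_def)
      moreover have "set (concat (as @ p' # bs)) = D"
        using ps(2) v p'(2) by (auto simp: asbs)
      moreover have "\<forall>q\<in>set (as @ p' # bs). q \<noteq> [] \<and> successively ?adj q"
        using ps(3) p' by (auto simp: asbs)
      moreover have "2 * length (as @ p' # bs) + card (?X D) \<le> 2 * card D"
        using count cardX by (simp add: asbs)
      ultimately show ?thesis by blast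
    qed
  qed
qed

end

section \<open>Components of an induced subgraph\<close>

context finite_multigraph
begin

lemma symmetric: "symmetric G"
  unfolding symmetric_conv by (metis arev_in_arcs head_arev tail_arev)

text \<open>
  In a symmetric digraph connectedness and strong connectedness coincide, so components inherit disjointness
  and closure under arcs from the strongly connected components.
\<close>

lemma components_subset_sccs:
  assumes S: "S \<subseteq> verts G"
  shows "components (G \<restriction> S) \<subseteq> pre_digraph.sccs (G \<restriction> S)"
proof
  interpret K: wf_digraph "G \<restriction> S" by (rule wellformed_induce_subgraph)
  fix C assume "C \<in> components (G \<restriction> S)"
  then have max: "K.max_subgraph connected C" by (simp add: components_def)
  have "arc_mono (connected :: ('a, 'b) pre_digraph \<Rightarrow> bool)"
    unfolding arc_mono_def
  proof (intro allI impI)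
    fix H1 H2 :: "('a, 'b) pre_digraph"
    assume H: "connected H1 \<and> subgraph H1 H2 \<and> verts H1 = verts H2"
    then have "spanning H1 H2" by (simp add: spanning_def)
    moreover have "wf_digraph H2" using H by blast
    ultimately show "connected H2" using H wf_digraph.connected_spanning_imp_connected by blast
  qed
  with max have ind: "induced_subgraph C (G \<restriction> S)" by (rule K.induced_subgraphI_arc_mono)
  have "symmetric (G \<restriction> S)"
    using symmetric induced_induce[OF S] by (rule induced_graph_imp_symmetric)
  then have sym: "symmetric C" using ind by (rule induced_graph_imp_symmetric)
  have "connected C" using max by (rule K.max_subgraph_prop)
  moreover have "wf_digraph C" using ind by blast
  ultimately have "strongly_connected C"
    using sym by (intro wf_digraph.symmetric_connected_imp_strongly_connected)
  then have "K.max_subgraph strongly_connected C"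
  proof (rule K.max_subgraphI)
    show "subgraph C (G \<restriction> S)" using ind by (rule induced_imp_subgraph)
    fix H assume H: "C \<noteq> H" "subgraph C H" "subgraph H (G \<restriction> S)"
    then have "wf_digraph H" by blast
    then have "connected H" if "strongly_connected H"
      using that wf_digraph.reachable_mk_symmetricI by (fastforce simp: connected_def strongly_connected_def)
    with max H show "\<not> strongly_connected H" by (auto simp: K.max_subgraph_def)
  qed
  then show "C \<in> K.sccs" unfolding K.sccs_altdef2 by simp
qed

lemma component_verts:
  assumes S: "S \<subseteq> verts G" and C: "C \<in> components (G \<restriction> S)"
  shows "verts C \<subseteq> S" "C = G \<restriction> verts C"
    and "\<And>e. e \<in> arcs G \<Longrightarrow> tail G e \<in> verts C \<Longrightarrow> head G e \<in> S \<Longrightarrow> head G e \<in> verts C"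
proof -
  interpret K: wf_digraph "G \<restriction> S" by (rule wellformed_induce_subgraph)
  have scc: "C \<in> K.sccs" using components_subset_sccs[OF S] C by blast
  then have ind: "induced_subgraph C (G \<restriction> S)" by (rule K.in_sccs_imp_induced)
  then show sub: "verts C \<subseteq> S" by (auto simp: induced_subgraph_def subgraph_def)
  have "C = (G \<restriction> S) \<restriction> verts C" using K.induce_eq_iff_induced[OF ind] by simp
  also have "\<dots> = G \<restriction> verts C" using sub by (auto simp: induce_subgraph_def)
  finally show "C = G \<restriction> verts C" .
  have sv: "verts C \<in> K.sccs_verts" using scc by (intro K.in_sccs_vertsI_sccs) blast
  fix e assume e: "e \<in> arcs G" "tail G e \<in> verts C" "head G e \<in> S"
  then have "e \<in> arcs (G \<restriction> S)" "arev e \<in> arcs (G \<restriction> S)" using sub by auto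
  from this[THEN K.in_arcs_imp_in_arcs_ends] have "tail G e \<rightarrow>\<^bsub>G \<restriction> S\<^esub> head G e" "head G e \<rightarrow>\<^bsub>G \<restriction> S\<^esub> tail G e"
    using e by simp_all
  then have "tail G e \<rightarrow>\<^sup>*\<^bsub>G \<restriction> S\<^esub> head G e" "head G e \<rightarrow>\<^sup>*\<^bsub>G \<restriction> S\<^esub> tail G e"
    by (simp_all add: K.reachable_adjI)
  then show "head G e \<in> verts C"
    using sv e(2) unfolding K.in_sccs_verts_conv_reachable by blast
qed

lemma components_disjoint:
  assumes S: "S \<subseteq> verts G" and C: "C \<in> components (G \<restriction> S)" "D \<in> components (G \<restriction> S)" "C \<noteq> D"
  shows "verts C \<inter> verts D = {}"
proof -
  interpret K: wf_digraph "G \<restriction> S" by (rule wellformed_induce_subgraph)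
  show ?thesis using components_subset_sccs[OF S] C by (intro K.scc_disj) auto
qed

end

section \<open>Counting the paths of a degree-2 subgraph\<close>

context finite_multigraph
begin

text \<open>
  Of the \<open>2 * card D\<close> arcs leaving \<open>D\<close>, those that do not stay in \<open>D\<close> enter \<open>B\<close>, and their reverses are
  among the \<open>2 * card B\<close> arcs leaving \<open>B\<close>.
\<close>

lemma degree2_count:
  assumes \<Gamma>: "\<Gamma> \<subseteq> arcs G" "\<And>e. e \<in> \<Gamma> \<Longrightarrow> arev e \<in> \<Gamma>"
    and fin: "finite D" "finite B"
    and deg: "\<And>v. v \<in> D \<union> B \<Longrightarrow> card {e \<in> \<Gamma>. tail G e = v} = 2"
    and nbr: "\<And>e. e \<in> \<Gamma> \<Longrightarrow> tail G e \<in> D \<Longrightarrow> head G e \<in> D \<union> B"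
  shows "2 * card D \<le> card {e \<in> \<Gamma>. tail G e \<in> D \<and> head G e \<in> D} + 2 * card B"
proof -
  have fin\<Gamma>: "finite {e \<in> \<Gamma>. Q e}" for Q using \<Gamma>(1) finite_subset[OF _ finite_arcs] by auto
  have count: "card {e \<in> \<Gamma>. tail G e \<in> A} = 2 * card A" if "finite A" "A \<subseteq> D \<union> B" for A
  proof -
    have "{e \<in> \<Gamma>. tail G e \<in> A} = (\<Union>v\<in>A. {e \<in> \<Gamma>. tail G e = v})" by auto
    then have "card {e \<in> \<Gamma>. tail G e \<in> A} = (\<Sum>v\<in>A. card {e \<in> \<Gamma>. tail G e = v})"
      using that(1) fin\<Gamma> by (simp add: card_UN_disjoint disjoint_iff)
    also have "\<dots> = (\<Sum>v\<in>A. 2)" using that(2) deg by (intro sum.cong refl) blast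
    finally show ?thesis by simp
  qed
  let ?in = "{e \<in> \<Gamma>. tail G e \<in> D \<and> head G e \<in> D}"
  let ?out = "{e \<in> \<Gamma>. tail G e \<in> D \<and> head G e \<notin> D}"
  have "{e \<in> \<Gamma>. tail G e \<in> D} = ?in \<union> ?out" by blast
  then have "2 * card D = card (?in \<union> ?out)" using count[of D] fin by simp
  also have "\<dots> \<le> card ?in + card ?out" by (rule card_Un_le)
  finally have "2 * card D \<le> card ?in + card ?out" .
  moreover have "card ?out = card (arev ` ?out)" by (simp add: card_image inj_on_arev)
  moreover have "card (arev ` ?out) \<le> card {e \<in> \<Gamma>. tail G e \<in> B}"
  proof (rule card_mono[OF fin\<Gamma>], rule image_subsetI)
    fix e assume e: "e \<in> ?out"
    then have "e \<in> arcs G" using \<Gamma> by blast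
    with e show "arev e \<in> {e \<in> \<Gamma>. tail G e \<in> B}" using nbr[of e] \<Gamma>(2)[of e] by auto
  qed
  moreover have "card {e \<in> \<Gamma>. tail G e \<in> B} = 2 * card B" using fin by (intro count) auto
  ultimately show ?thesis by linarith
qed

end

section \<open>Eigenvalues on forests are roots\<close>

context weighted_multigraph
begin

lemma edge_weight_pos:
  assumes "e \<in> arcs G"
  shows "0 < edge_weight (tail G e) (head G e)"
  unfolding edge_weight_def
  by (rule sum_pos2[of _ e]) (use assms w_nz in auto)

lemma edge_weight_eq_0:
  "(\<And>e. e \<in> arcs G \<Longrightarrow> tail G e = v \<Longrightarrow> head G e \<noteq> u) \<Longrightarrow> edge_weight v u = 0"
  unfolding edge_weight_def by (intro sum.neutral) auto

definition hopping :: "'a \<Rightarrow> 'a \<Rightarrow> complex" where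
  "hopping v u = (\<Sum>e\<in>{e \<in> arcs G. tail G e = v \<and> head G e = u}. w e)"

lemma leaf_imp_pendant:
  assumes v: "v \<in> B" and leaf: "card (arcs_into B v) \<le> 1"
  shows "pendant hopping B v"
proof -
  let ?A = "\<lambda>v u. {e \<in> arcs G. tail G e = v \<and> head G e = u}"
  have rev: "?A y v = arev ` ?A v y" for y
  proof (intro set_eqI iffI)
    fix e assume "e \<in> ?A y v"
    then show "e \<in> arev ` ?A v y" by (intro image_eqI[of _ _ "arev e"]) auto
  qed auto
  have none: "hopping v y = 0 \<and> hopping y v = 0 \<and> edge_weight v y = 0" if "?A v y = {}" for y
  proof -
    have "?A y v = {}" using rev[of y] that by (simp only: image_empty)
    with that show ?thesis unfolding hopping_def edge_weight_def by (simp only: sum.empty)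
  qed
  have fin: "finite (arcs_into B v)" by (simp add: arcs_into_def)
  show ?thesis
  proof (cases "arcs_into B v = {}")
    case True
    then have "?A v y = {}" if "y \<in> B" for y using that by (auto simp: arcs_into_def)
    then show ?thesis unfolding pendant_def by (intro disjI1 ballI none)
  next
    case False
    then obtain e where e: "e \<in> arcs_into B v" by blast
    then have out: "f = e" if "f \<in> arcs_into B v" for f
      using that leaf fin by (metis One_nat_def card_le_Suc0_iff_eq)
    have eG: "e \<in> arcs G" "tail G e = v" "head G e \<in> B" using e by (auto simp: arcs_into_def)
    let ?u = "head G e"
    have "?u \<noteq> v"
    proof
      assume "?u = v"
      then have "arev e \<in> arcs_into B v" using eG by (simp add: arcs_into_def)
      from out[OF this] show False using arev_neq[OF eG(1)] by simp
    qed
    have sub: "?A v y \<subseteq> arcs_into B v" if "y \<in> B" for y using that by (auto simp: arcs_into_def)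
    have A: "?A v ?u = {e}" using sub[OF eG(3)] out eG by blast
    then have "?A ?u v = {arev e}" using rev[of ?u] by simp
    with A have h: "hopping v ?u = w e" "hopping ?u v = w (arev e)"
      "edge_weight v ?u = (cmod (w e))\<^sup>2"
      by (simp_all add: hopping_def edge_weight_def)
    have "?A v y = {}" if "y \<in> B - {?u}" for y
      using that out sub[of y] by blast
    then have "\<forall>y\<in>B - {?u}. hopping v y = 0 \<and> hopping y v = 0 \<and> edge_weight v y = 0"
      by (intro ballI none)
    moreover have "hopping v ?u \<noteq> 0" "hopping ?u v \<noteq> 0" using h w_nz eG(1) by auto
    moreover have "of_real (edge_weight v ?u) = hopping v ?u * hopping ?u v"
      using complex_norm_square[of "w e"] by (simp add: h w_arev[OF eG(1)])
    moreover have "?u \<in> B - {v}" using \<open>?u \<noteq> v\<close> eG(3) by simp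
    ultimately show ?thesis unfolding pendant_def by blast
  qed
qed

lemma eigenvalue_imp_near_root:
  assumes A: "A \<subseteq> verts G" and leaf: "\<And>B. B \<subseteq> A \<Longrightarrow> B \<noteq> {} \<Longrightarrow> \<exists>v\<in>B. card (arcs_into B v) \<le> 1"
    and ev: "schroedinger_eigenvalue (G \<restriction> A) w V (of_real lam)"
  shows "near V lam A 0 = 0"
proof -
  from ev obtain f where f0: "\<And>v. v \<notin> A \<Longrightarrow> f v = 0" and f: "f \<noteq> (\<lambda>v. 0)"
    and eq: "schroedinger_op (G \<restriction> A) w V f = (\<lambda>v. of_real lam * f v)"
    by (auto simp: schroedinger_eigenvalue_def ell2_def)
  have fin: "finite A" using A finite_verts by (rule finite_subset)
  show ?thesis
    unfolding near_def
  proof (rule kernel_imp_M_eq_0[OF fin])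
    show "\<exists>v\<in>B. pendant hopping B v" if "B \<subseteq> A" "B \<noteq> {}" for B
      using leaf[OF that] leaf_imp_pendant by blast
    show "\<exists>u\<in>A. f u \<noteq> 0" using f f0 by fastforce
    fix u assume u: "u \<in> A"
    have entry: "schroedinger_entry (G \<restriction> A) w V u y = hopping u y + (if u = y then of_real (V u) else 0)"
      if "y \<in> A" for y
    proof -
      have "{e \<in> arcs (G \<restriction> A). tail (G \<restriction> A) e = u \<and> head (G \<restriction> A) e = y}
          = {e \<in> arcs G. tail G e = u \<and> head G e = y}" using that u by auto
      then show ?thesis by (simp only: schroedinger_entry_def hopping_def) auto
    qed
    have "of_real lam * f u = (\<Sum>y\<in>A. schroedinger_entry (G \<restriction> A) w V u y * f y)"
      using fun_cong[OF eq, of u] u by (simp add: schroedinger_op_def)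
    also have "\<dots> = (\<Sum>y\<in>A. hopping u y * f y + (if u = y then of_real (V u) * f y else 0))"
      by (intro sum.cong refl) (simp add: entry distrib_right)
    also have "\<dots> = (\<Sum>y\<in>A. hopping u y * f y) + of_real (V u) * f u"
      using fin u by (simp add: sum.distrib)
    finally show "Complex (lam - V u) 0 * f u = (\<Sum>y\<in>A. hopping u y * f y)"
      by (simp add: complex_of_real_def[symmetric] left_diff_distrib)
  qed
qed

end

section \<open>The matching polynomial after removing a degree-2 subgraph\<close>

theorem propositionA2:
  fixes G :: "('a, 'b) pre_digraph" and arev :: "'b \<Rightarrow> 'b"
    and w :: "'b \<Rightarrow> complex" and V :: "'a \<Rightarrow> real"
    and lam :: real and S :: "'a set" and \<gamma> :: "('a, 'b) pre_digraph"
  assumes "finite_multigraph G arev"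
    and "schroedinger_data G arev w"
    and "S \<subseteq> verts G"
    and "acyclic_multigraph arev (G \<restriction> S)"
    and "\<And>C. C \<in> components (G \<restriction> S) \<Longrightarrow>
           schroedinger_eigenvalue C w V (complex_of_real lam)"
    and "card (boundary G (G \<restriction> S)) < cc (G \<restriction> S)"
    and "degree_subgraph 2 arev \<gamma> G"
  shows "poly (matching_poly arev w V (G \<restriction> (verts G - verts \<gamma>))) (complex_of_real lam) = 0"
proof -
  interpret finite_multigraph G arev by fact
  interpret weighted_multigraph G arev w by unfold_locales fact
  note S = assms(3)
  \<comment> \<open>\<open>D\<close> collects the vertices of \<open>S\<close> that \<open>\<gamma>\<close> removes; inside it \<open>\<gamma>\<close> is a union of paths.\<close>
  define W where "W = verts G - verts \<gamma>"
  define \<Gamma> where "\<Gamma> = arcs \<gamma>"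
  define \<B> where "\<B> = boundary G (G \<restriction> S)"
  define D where "D = S - W"
  define I where "I = components (G \<restriction> S)"
  have leaf: "\<exists>v\<in>B. card (arcs_into B v) \<le> 1" if "B \<subseteq> S" "B \<noteq> {}" for B
    using acyclic_imp_leaf[OF assms(4) S that] .
  have fin: "finite W" "finite S" "finite \<B>" "finite D"
    using finite_subset[OF S finite_verts] by (auto simp: W_def \<B>_def D_def boundary_def)
  \<comment> \<open>An infinite set has cardinality 0, which is not greater than the size of the boundary.\<close>
  have finI: "finite I" using assms(6) by (auto simp: I_def cc_def intro: card_ge_0_finite)

  have F: "near V lam S \<in> O[at_right 0](\<lambda>\<epsilon>. of_real \<epsilon> ^ card I)"
  proof (rule near_forest[where A = verts, OF fin(2) finI])
    fix C assume "C \<in> I"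
    then have C: "C \<in> components (G \<restriction> S)" by (simp add: I_def)
    show sub: "verts C \<subseteq> S" by (rule component_verts(1)[OF S C])
    show "verts C \<inter> verts D = {}" if "D \<in> I" "C \<noteq> D" for D
      using components_disjoint[OF S C, of D] that by (simp add: I_def)
    show "edge_weight u v = 0" if "u \<in> verts C" "v \<in> S - verts C" for u v
      using component_verts(3)[OF S C] that by (intro edge_weight_eq_0) auto
    show "near V lam (verts C) 0 = 0"
    proof (rule eigenvalue_imp_near_root)
      show "verts C \<subseteq> verts G" using sub S by blast
      show "\<exists>v\<in>B. card (arcs_into B v) \<le> 1" if "B \<subseteq> verts C" "B \<noteq> {}" for B
        using leaf that sub by blast
      show "schroedinger_eigenvalue (G \<restriction> verts C) w V (of_real lam)"
        using assms(5)[OF C] component_verts(2)[OF S C] by simp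
    qed
  qed

  have sub\<gamma>: "subgraph \<gamma> G" and rev\<gamma>: "\<And>e. e \<in> \<Gamma> \<Longrightarrow> arev e \<in> \<Gamma>"
    and deg\<gamma>: "\<And>v. v \<in> verts \<gamma> \<Longrightarrow> out_degree \<gamma> v = 2"
    using assms(7) by (auto simp: degree_subgraph_def multi_subgraph_def \<Gamma>_def)
  interpret \<gamma>: wf_digraph \<gamma> using sub\<gamma> by auto
  have th: "tail \<gamma> = tail G" "head \<gamma> = head G" using sub\<gamma> by (auto simp: subgraph_def compatible_def)
  have \<Gamma>G: "\<Gamma> \<subseteq> arcs G" using sub\<gamma> by (auto simp: subgraph_def \<Gamma>_def)
  have deg: "card {e \<in> \<Gamma>. tail G e = v} = 2" if "v \<in> verts \<gamma>" for v
    using deg\<gamma>[OF that] by (simp add: out_degree_def out_arcs_def th \<Gamma>_def)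
  have D: "D \<subseteq> verts \<gamma>" "D \<subseteq> S" using S by (auto simp: D_def W_def)
  have bd: "head G e \<in> S \<union> \<B>" if "e \<in> arcs G" "tail G e \<in> S" for e
    using that in_arcs_imp_in_arcs_ends[OF that(1)] by (auto simp: \<B>_def boundary_def)

  have leafD: "\<exists>v\<in>B. card (arcs_into B v) \<le> 1" if "B \<subseteq> D" "B \<noteq> {}" for B
    using leaf[of B] that D(2) by blast
  have degD: "card {e \<in> \<Gamma>. tail G e = v} \<le> 2" if "v \<in> D" for v
    using deg[of v] that D(1) by auto
  obtain ps where ps: "distinct (concat ps)" "set (concat ps) = D"
    "\<And>p. p \<in> set ps \<Longrightarrow> p \<noteq> [] \<and> successively (\<lambda>u v. \<exists>e\<in>\<Gamma>. tail G e = u \<and> head G e = v) p"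
    "2 * length ps + card {e \<in> \<Gamma>. tail G e \<in> D \<and> head G e \<in> D} \<le> 2 * card D"
    using path_cover[OF fin(4) leafD \<Gamma>G rev\<gamma> degD] by blast
  have "2 * card D \<le> card {e \<in> \<Gamma>. tail G e \<in> D \<and> head G e \<in> D} + 2 * card (\<B> - W)"
  proof (rule degree2_count[OF \<Gamma>G rev\<gamma> fin(4)])
    show "finite (\<B> - W)" using fin by simp
    have "\<B> - W \<subseteq> verts \<gamma>" by (auto simp: \<B>_def W_def boundary_def)
    then show "card {e \<in> \<Gamma>. tail G e = v} = 2" if "v \<in> D \<union> (\<B> - W)" for v
      using that D deg by blast
    fix e assume e: "e \<in> \<Gamma>" "tail G e \<in> D"
    then have "head G e \<in> S \<union> \<B>" using bd D \<Gamma>G by blast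
    moreover have "head G e \<in> verts \<gamma>" using e \<gamma>.head_in_verts[of e] by (simp add: \<Gamma>_def th)
    ultimately show "head G e \<in> D \<union> (\<B> - W)" by (auto simp: D_def W_def)
  qed
  with ps(4) have "length ps \<le> card (\<B> - W)" by simp
  moreover have "card \<B> = card (\<B> \<inter> W) + card (\<B> - W)" using fin by (simp add: card_Int_Diff)
  ultimately have few: "card (\<B> \<inter> W) + length ps < card I"
    using assms(6) by (simp add: \<B>_def I_def cc_def)

  have "near V lam W 0 = 0"
  proof (rule near_eq_0_if_few_deletions[OF fin(1-3) few F])
    show "edge_weight u v = 0" if "u \<in> W \<inter> S" "v \<in> W - S - \<B>" for u v
      using bd that by (intro edge_weight_eq_0) auto
    show "\<B> \<inter> S = {}" by (auto simp: \<B>_def boundary_def)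
    show "set (concat ps) = S - W" "distinct (concat ps)" using ps by (simp_all add: D_def)
    fix p assume "p \<in> set ps"
    then have p: "p \<noteq> []" "successively (\<lambda>u v. \<exists>e\<in>\<Gamma>. tail G e = u \<and> head G e = v) p"
      using ps(3) by blast+
    have "successively (\<lambda>u v. 0 < edge_weight u v) p"
      by (rule successively_mono[OF p(2)]) (use \<Gamma>G edge_weight_pos in blast)
    with p(1) show "p \<noteq> [] \<and> successively (\<lambda>u v. 0 < edge_weight u v) p" by simp
  qed
  then show ?thesis
    using poly_matching_poly_near[of W V lam] by (simp add: W_def)
qed

end
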